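(* For any $I \subseteq \mathbb{Z}^+$, the language $\mathtt{LOG(AM75'(I))}$ can be recognized by a bounded-error PTM in space $O(\log \log \log (n))$.
   Context: A probabilistic Turing machine (PTM) has a read--only two--way input tape, on which the input is placed between a left end-marker and a right end-marker (the dollar sign \$), and a two--way work tape; it makes random choices with arbitrary real transition probabilities. Bounded-error recognition means members are accepted with probability at least $1-\epsilon$ and non-members with probability at most $\epsilon$, for some $\epsilon<1/2$; $n$ is the input length. For $n>0$ let $F(n)=\min\{i \mid i \text{ does not divide } n\}$, and $\mathtt{AM75'}=\{a^n \mid n>0 \text{ and } F(n) \text{ is a power of } 64\}$. Ordering $\Sigma^*$ lexicographically with $\Sigma^*(i)$ its $i$-th element ($\Sigma^*(1)$ being the empty string), define for $I\subseteq\mathbb{Z}^+$: $\mathtt{AM75'(I)}=\{a^n \mid a^n\in\mathtt{AM75'} \text{ and } \Sigma^{*}(\log_{64}F(n)) \in I\}$. For a binary language $L\subseteq\{0,1\}^*$ (with $a$ identified with a binary symbol), $\mathtt{LOG(L)} = \{ 0 (1 w_1) 0^{2^1} (1 w_2) 0^{2^2} (1 w_3) 0^{2^3} \cdots 0^{2^{m-1}} (1 w_m) 0^{2^m} \mid w = w_1 w_2 \cdots w_m \in L \}$. *)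

theory Defs
  imports "HOL-Probability.Probability_Mass_Function" "HOL-Library.Landau_Symbols"
begin

section \<open>Probabilistic Turing machines\<close>

datatype 'a input_symbol = LeftEnd | RightEnd | Sym 'a

datatype move = MoveLeft | Stay | MoveRight

text \<open>
  States and work symbols are coded as natural numbers so that one can quantify existentially
  over machines. The real transition probabilities
  \<open>\<delta> q \<sigma> \<gamma> (q', \<gamma>', d, d') \<in> [0, 1]\<close>, summing to 1 for fixed \<open>q, \<sigma>, \<gamma>\<close>, are a \<open>pmf\<close>.
\<close>

record 'a ptm =
  states :: "nat set"
  work_symbols :: "nat set"
  blank :: nat
  initial :: nat
  accepting :: nat
  rejecting :: nat
  trans :: "nat \<Rightarrow> 'a input_symbol \<Rightarrow> nat \<Rightarrow> (nat \<times> nat \<times> move \<times> move) pmf"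

text \<open>In a move \<open>(q', \<gamma>', d, d')\<close>, \<open>d\<close> moves the input head and \<open>d'\<close> the work head.\<close>

definition well_formed :: "'a ptm \<Rightarrow> bool" where
  "well_formed M \<longleftrightarrow>
     finite (states M) \<and> finite (work_symbols M) \<and> blank M \<in> work_symbols M \<and>
     {initial M, accepting M, rejecting M} \<subseteq> states M \<and> accepting M \<noteq> rejecting M \<and>
     (\<forall>q\<in>states M. \<forall>\<sigma>. \<forall>\<gamma>\<in>work_symbols M. \<forall>(q', \<gamma>', d, d')\<in>set_pmf (trans M q \<sigma> \<gamma>).
        q' \<in> states M \<and> \<gamma>' \<in> work_symbols M \<and>
        (\<sigma> = LeftEnd \<longrightarrow> d \<noteq> MoveLeft) \<and> (\<sigma> = RightEnd \<longrightarrow> d \<noteq> MoveRight))"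

text \<open>
  The component \<open>visited\<close> does not influence the computation; it records the work tape cells
  scanned so far, for measuring space.
\<close>

record config =
  state :: nat
  input_pos :: int
  work_pos :: int
  work_tape :: "int \<Rightarrow> nat"
  visited :: "int set"

definition input_at :: "'a list \<Rightarrow> int \<Rightarrow> 'a input_symbol" where
  "input_at x i =
     (if i \<le> 0 then LeftEnd else if i > int (length x) then RightEnd else Sym (x ! nat (i - 1)))"

fun offset :: "move \<Rightarrow> int" where
  "offset MoveLeft = -1"
| "offset Stay = 0"
| "offset MoveRight = 1"

definition initial_config :: "'a ptm \<Rightarrow> config" where
  "initial_config M =
     \<lparr>state = initial M, input_pos = 0, work_pos = 0, work_tape = (\<lambda>_. blank M), visited = {0}\<rparr>"

definition apply_move :: "config \<Rightarrow> nat \<times> nat \<times> move \<times> move \<Rightarrow> config" where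
  "apply_move c = (\<lambda>(q', \<gamma>', d, d').
     \<lparr>state = q',
      input_pos = input_pos c + offset d,
      work_pos = work_pos c + offset d',
      work_tape = (work_tape c)(work_pos c := \<gamma>'),
      visited = insert (work_pos c + offset d') (visited c)\<rparr>)"

definition step :: "'a ptm \<Rightarrow> 'a list \<Rightarrow> config \<Rightarrow> config pmf" where
  "step M x c =
     (if state c = accepting M \<or> state c = rejecting M then return_pmf c
      else map_pmf (apply_move c)
             (trans M (state c) (input_at x (input_pos c)) (work_tape c (work_pos c))))"

primrec run :: "'a ptm \<Rightarrow> 'a list \<Rightarrow> nat \<Rightarrow> config pmf" where
  "run M x 0 = return_pmf (initial_config M)"
| "run M x (Suc t) = bind_pmf (run M x t) (step M x)"

text \<open>
  Halting configurations persist and \<open>visited\<close> only grows, so both suprema below are limits of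
  increasing sequences: the probabilities of ever accepting, resp. of ever visiting more than
  \<open>b\<close> work tape cells.
\<close>

definition accept_prob :: "'a ptm \<Rightarrow> 'a list \<Rightarrow> real" where
  "accept_prob M x = (SUP t. measure_pmf.prob (run M x t) {c. state c = accepting M})"

definition excess_prob :: "'a ptm \<Rightarrow> 'a list \<Rightarrow> nat \<Rightarrow> real" where
  "excess_prob M x b = (SUP t. measure_pmf.prob (run M x t) {c. card (visited c) > b})"

definition recognizes_with_error :: "'a ptm \<Rightarrow> 'a list set \<Rightarrow> real \<Rightarrow> bool" where
  "recognizes_with_error M L \<epsilon> \<longleftrightarrow>
     (\<forall>x\<in>L. accept_prob M x \<ge> 1 - \<epsilon>) \<and> (\<forall>x. x \<notin> L \<longrightarrow> accept_prob M x \<le> \<epsilon>)"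

text \<open>
  On members the bound holds on every computation of nonzero probability; on non-members it holds,
  like the correctness of the answer, with probability at least \<open>1 - \<epsilon>\<close>. It is not demanded on
  every computation on every input: the computations of nonzero probability are those of a
  nondeterministic machine, and a nondeterministic machine using space \<open>o(log log n)\<close> on all
  computations on all inputs uses constant space, so classes below \<open>log log n\<close> would collapse.
\<close>

definition space_bounded :: "'a ptm \<Rightarrow> 'a list set \<Rightarrow> real \<Rightarrow> (nat \<Rightarrow> nat) \<Rightarrow> bool" where
  "space_bounded M L \<epsilon> s \<longleftrightarrow>
     (\<forall>x\<in>L. excess_prob M x (s (length x)) = 0) \<and>
     (\<forall>x. x \<notin> L \<longrightarrow> excess_prob M x (s (length x)) \<le> \<epsilon>)"

definition bounded_error_recognizable_in_space :: "'a list set \<Rightarrow> (nat \<Rightarrow> real) \<Rightarrow> bool" where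
  "bounded_error_recognizable_in_space L f \<longleftrightarrow>
     (\<exists>(M :: 'a ptm) \<epsilon> s. well_formed M \<and> 0 \<le> \<epsilon> \<and> \<epsilon> < 1 / 2 \<and> recognizes_with_error M L \<epsilon> \<and>
        space_bounded M L \<epsilon> s \<and> (\<lambda>n. real (s n)) \<in> O(f))"


section \<open>The languages\<close>

text \<open>The binary symbols 0 and 1 are \<open>False\<close> and \<open>True\<close>.\<close>

text \<open>
  The order on words is by length first, then lexicographic, as it must be for every word to have
  a finite position; positions start at 1.
\<close>

definition nth_word :: "nat \<Rightarrow> bool list" where
  "nth_word i = (THE w. card {v. (v, w) \<in> lenlex {(b, c). b < c}} + 1 = i)"

text \<open>Without \<open>i > 0\<close> the minimum would be 0, as 0 does not divide \<open>n > 0\<close>.\<close>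

definition least_nondivisor :: "nat \<Rightarrow> nat" where
  "least_nondivisor n = (LEAST i. i > 0 \<and> \<not> i dvd n)"

definition AM75' :: "'a \<Rightarrow> 'a list set" where
  "AM75' a = {replicate n a | n. n > 0 \<and> (\<exists>k. least_nondivisor n = 64 ^ k)}"

text \<open>
  The condition that the word at position \<open>log\<^sub>6\<^sub>4 (least_nondivisor n)\<close> belongs to
  \<open>I\<close> identifies the set \<open>I\<close> of positions with the set of words at these positions.
\<close>

definition AM75'_restrict :: "'a \<Rightarrow> nat set \<Rightarrow> 'a list set" where
  "AM75'_restrict a I =
     {replicate n a | n. replicate n a \<in> AM75' a \<and>
        (\<exists>k. least_nondivisor n = 64 ^ k \<and> nth_word k \<in> nth_word ` I)}"

definition log_word :: "bool list \<Rightarrow> bool list" where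
  "log_word w =
     False # concat (map (\<lambda>i. [True, w ! (i - 1)] @ replicate (2 ^ i) False) [1..<length w + 1])"

definition LOG :: "bool list set \<Rightarrow> bool list set" where
  "LOG L = log_word ` L"

end

theory Submission
  imports Defs "HOL-Library.Sublist"
begin

text \<open>
  The machine first checks in constant space that the input is \<open>0 (1 a) 0\<^sup>m\<^sup>1 (1 a) 0\<^sup>m\<^sup>2 \<dots>\<close> with each
  block of zeros twice as long as its predecessor. It makes random passes over the input that
  survive until the right end with tiny probability and otherwise restart. An accepting pass
  survives with a probability proportional to the product of \<open>\<theta>\<close> to the power \<open>2m + m'\<close> over
  neighbouring blocks of lengths \<open>m, m'\<close>, a rejecting pass to that of the arithmetic mean of
  \<open>\<theta>\<close> to the powers \<open>4m\<close> and \<open>2m'\<close>. The two products agree if all \<open>m' = 2m\<close>, and otherwise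
  the second exceeds the first by a large factor.

  If the check succeeds, the machine counts the \<open>n\<close> blocks modulo \<open>i = 1, 2, \<dots>\<close> on a work tape of
  \<open>O(log i)\<close> cells until it meets the least nondivisor \<open>F\<close> of \<open>n\<close>. Since \<open>n\<close> is exponential in
  \<open>F\<close> and the input length is exponential in \<open>n\<close>, this takes triply logarithmic space. If
  \<open>F = 64\<^sup>k\<close>, the machine tosses a biased coin \<open>F\<^sup>2\<close> times and counts the heads modulo \<open>F\<close>. The
  bias stores membership of \<open>k\<close> in its base-64 digit number \<open>k + 1\<close>, and the earlier digits
  contribute a multiple of \<open>F\<close> to the expected number of heads, so by Chebyshev's inequality the
  count reveals whether \<open>k\<close> belongs to the set.
\<close>

section \<open>Reachability probabilities\<close>

text \<open>Unfolds at the first step, where \<open>run\<close> unfolds at the last, and starts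
  anywhere: first-step analysis needs both.\<close>

primrec run_from :: "'a ptm \<Rightarrow> 'a list \<Rightarrow> nat \<Rightarrow> config \<Rightarrow> config pmf" where
  "run_from M x 0 c = return_pmf c"
| "run_from M x (Suc t) c = bind_pmf (step M x c) (run_from M x t)"

lemma run_from_Suc_right:
  "run_from M x (Suc t) c = bind_pmf (run_from M x t c) (step M x)"
proof (induction t arbitrary: c)
  case 0
  have "run_from M x 0 = return_pmf" by auto
  then show ?case by (simp add: bind_return_pmf bind_return_pmf')
next
  case (Suc t)
  have "run_from M x (Suc (Suc t)) c = bind_pmf (step M x c) (run_from M x (Suc t))"
    by simp
  also have "\<dots> = bind_pmf (step M x c) (\<lambda>c. bind_pmf (run_from M x t c) (step M x))"
    by (intro bind_pmf_cong refl Suc)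
  also have "\<dots> = bind_pmf (run_from M x (Suc t) c) (step M x)"
    by (simp add: bind_assoc_pmf)
  finally show ?case .
qed

lemma run_eq_run_from: "run M x t = run_from M x t (initial_config M)"
  by (induction t) (simp_all add: run_from_Suc_right del: run_from.simps(2))

text \<open>Acceptance and excess of space are both events of ever entering an absorbing set, so the
  machine is analysed once for an unspecified absorbing \<open>T\<close>.\<close>

definition hit :: "'a ptm \<Rightarrow> 'a list \<Rightarrow> config set \<Rightarrow> config \<Rightarrow> real" where
  "hit M x T c = (SUP t. measure_pmf.prob (run_from M x t c) T)"

definition absorbing :: "'a ptm \<Rightarrow> 'a list \<Rightarrow> config set \<Rightarrow> bool" where
  "absorbing M x T \<longleftrightarrow> (\<forall>c\<in>T. set_pmf (step M x c) \<subseteq> T)"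

lemma accept_prob_eq_hit:
  "accept_prob M x = hit M x {c. state c = accepting M} (initial_config M)"
  by (simp add: accept_prob_def hit_def run_eq_run_from)

lemma excess_prob_eq_hit:
  "excess_prob M x b = hit M x {c. card (visited c) > b} (initial_config M)"
  by (simp add: excess_prob_def hit_def run_eq_run_from)

lemma absorbing_accept: "absorbing M x {c. state c = accepting M}"
  by (auto simp: absorbing_def step_def)

lemma absorbing_excess: "absorbing M x {c. card (visited c) > b}"
proof -
  \<comment> \<open>An infinite \<open>A\<close> has \<open>card A = 0\<close>, contradicting
    \<open>b < card A\<close>.\<close>
  have "b < card (insert z A)" if "b < card A" for z :: int and A
    using that by (cases "finite A") (auto simp: card_insert_if)
  then show ?thesis
    by (auto simp: absorbing_def step_def apply_move_def split: if_splits)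
qed

lemma prob_bind_pmf:
  "measure_pmf.prob (bind_pmf p f) A = measure_pmf.expectation p (\<lambda>x. measure_pmf.prob (f x) A)"
proof -
  have "ennreal (measure_pmf.prob (bind_pmf p f) A) = (\<integral>\<^sup>+x. ennreal (measure_pmf.prob (f x) A) \<partial>p)"
    by (simp flip: measure_pmf.emeasure_eq_measure)
  also have "\<dots> = ennreal (measure_pmf.expectation p (\<lambda>x. measure_pmf.prob (f x) A))"
    by (intro nn_integral_eq_integral measure_pmf.integrable_const_bound[where B = 1]) auto
  finally show ?thesis
    by (subst (asm) ennreal_inj) (auto intro: integral_nonneg_AE)
qed

context
  fixes M :: "'a ptm" and x :: "'a list" and T :: "config set"
  assumes T: "absorbing M x T"
begin

lemma prob_run_from_mono: "mono (\<lambda>t. measure_pmf.prob (run_from M x t c) T)"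
proof (rule incseq_SucI)
  fix t
  have "measure_pmf.prob (step M x c') T \<ge> indicator T c'" for c'
  proof (cases "c' \<in> T")
    case True
    then have "set_pmf (step M x c') \<subseteq> T" using T by (auto simp: absorbing_def)
    then have "measure_pmf.prob (step M x c') T = 1"
      by (simp add: measure_pmf.prob_eq_1 AE_measure_pmf_iff subset_iff)
    then show ?thesis by simp
  qed simp
  then have "measure_pmf.expectation (run_from M x t c) (indicator T) \<le>
    measure_pmf.expectation (run_from M x t c) (\<lambda>c'. measure_pmf.prob (step M x c') T)"
    by (intro integral_mono measure_pmf.integrable_const_bound[where B = 1]) auto
  then show "measure_pmf.prob (run_from M x t c) T \<le> measure_pmf.prob (run_from M x (Suc t) c) T"
    unfolding run_from_Suc_right prob_bind_pmf by simp
qed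

lemma hit_LIMSEQ: "(\<lambda>t. measure_pmf.prob (run_from M x t c) T) \<longlonglongrightarrow> hit M x T c"
  unfolding hit_def
  by (intro LIMSEQ_incseq_SUP prob_run_from_mono) (auto intro!: bdd_aboveI[where M = 1])

lemma hit_bounds: "0 \<le> hit M x T c" "hit M x T c \<le> 1"
  using hit_LIMSEQ[of c] by (auto intro: LIMSEQ_le_const LIMSEQ_le_const2)

text \<open>Conditioning on the first step is exact at every time \<open>t\<close>; dominated
  convergence with bound 1 carries it to the limit.\<close>

lemma hit_step: "hit M x T c = measure_pmf.expectation (step M x c) (hit M x T)"
proof (rule LIMSEQ_unique)
  show "(\<lambda>t. measure_pmf.prob (run_from M x (Suc t) c) T) \<longlonglongrightarrow> hit M x T c"
    using hit_LIMSEQ by (rule LIMSEQ_Suc)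
  show "(\<lambda>t. measure_pmf.prob (run_from M x (Suc t) c) T)
    \<longlonglongrightarrow> measure_pmf.expectation (step M x c) (hit M x T)"
    unfolding run_from.simps prob_bind_pmf
    by (rule integral_dominated_convergence[where w = "\<lambda>_. 1"]) (auto intro: hit_LIMSEQ)
qed

lemma hit_halted:
  assumes "state c = accepting M \<or> state c = rejecting M"
  shows "hit M x T c = indicator T c"
proof -
  have "run_from M x t c = return_pmf c" for t
    using assms by (induction t) (simp_all add: step_def bind_return_pmf)
  then show ?thesis by (simp add: hit_def)
qed

end

section \<open>Sweeps over the work tape\<close>

datatype sweep_op = Nop | Inc | Tick nat | Test | Read

text \<open>
  A cell holds one base-64 digit, least significant first, of each of four numbers. On the way to
  the right the pair of flags is, for \<open>Tick k\<close>, the carry of the incremented number \<open>k\<close> and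
  whether its digits so far agree with those of number 0; if they all do, the way back resets it,
  so that \<open>Tick k\<close> counts modulo number 0. For \<open>Test\<close> the flags say whether the digits so far
  are those of 0, and whether they are those of 0 or of a power of 64.
\<close>

fun rewrite_right :: "sweep_op \<Rightarrow> bool \<times> bool \<Rightarrow> nat list \<Rightarrow> (bool \<times> bool) \<times> nat list" where
  "rewrite_right Nop s v = (s, v)"
| "rewrite_right Inc (c, e) v = ((c \<and> v ! 0 = 63, e), v[0 := (v ! 0 + of_bool c) mod 64])"
| "rewrite_right (Tick k) (c, e) v =
     (let d = (v ! k + of_bool c) mod 64 in ((c \<and> v ! k = 63, e \<and> d = v ! 0), v[k := d]))"
| "rewrite_right Test (z, e) v = ((z \<and> v ! 0 = 0, e \<and> (v ! 0 = 0 \<or> z \<and> v ! 0 = 1)), v)"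
| "rewrite_right Read (b, e) v = ((if v ! 0 = 0 then v ! 3 \<ge> 32 else b, e), v)"

text \<open>Only an increment lengthens the tape: a carry out of the last cell becomes a new leading
  digit 1 of number 0.\<close>

fun extension :: "sweep_op \<Rightarrow> bool \<times> bool \<Rightarrow> nat list option" where
  "extension Inc (c, e) = (if c then Some [1, 0, 0, 0] else None)"
| "extension _ _ = None"

text \<open>\<open>Test\<close> clears number 1 because it still holds the remainder of the block
  count when it is reused as a toss counter.\<close>

fun rewrite_left :: "sweep_op \<Rightarrow> bool \<times> bool \<Rightarrow> nat list \<Rightarrow> nat list" where
  "rewrite_left (Tick k) (c, e) v = (if e then v[k := 0] else v)"
| "rewrite_left Test _ v = v[1 := 0]"
| "rewrite_left _ _ v = v"

primrec sweep_right :: "sweep_op \<Rightarrow> bool \<times> bool \<Rightarrow> nat list list \<Rightarrow> (bool \<times> bool) \<times> nat list list" where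
  "sweep_right p s [] = (s, [])"
| "sweep_right p s (v # vs) =
     (let (s', v') = rewrite_right p s v; (s'', vs') = sweep_right p s' vs in (s'', v' # vs'))"

definition sweep :: "sweep_op \<Rightarrow> nat list list \<Rightarrow> (bool \<times> bool) \<times> nat list list" where
  "sweep p vs = (let (s, vs') = sweep_right p (True, True) vs
     in (s, map (rewrite_left p s) vs' @
          (case extension p s of None \<Rightarrow> [] | Some v \<Rightarrow> [v])))"

definition cell_symbols :: "nat list option set" where
  "cell_symbols = insert None (Some ` {v. set v \<subseteq> {..<64} \<and> length v = 4})"

lemma finite_cell_symbols: "finite cell_symbols"
  by (simp add: cell_symbols_def finite_lists_length_eq)

lemma set_list_update_less: "set v \<subseteq> {..<64} \<Longrightarrow> d < 64 \<Longrightarrow> set (v[k := d]) \<subseteq> {..<64::nat}"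
  using set_update_subset_insert[of v k d] by auto

lemma rewrite_right_symbols:
  "Some v \<in> cell_symbols \<Longrightarrow> Some (snd (rewrite_right p s v)) \<in> cell_symbols"
  by (cases p; cases s) (auto simp: cell_symbols_def Let_def dest!: set_list_update_less[THEN subsetD, rotated 2])

lemma rewrite_left_symbols:
  "Some v \<in> cell_symbols \<Longrightarrow> Some (rewrite_left p s v) \<in> cell_symbols"
  by (cases p; cases s) (auto simp: cell_symbols_def Let_def dest!: set_list_update_less[THEN subsetD, rotated 2])

lemma extension_symbols: "extension p s \<in> cell_symbols"
  by (cases p; cases s) (auto simp: cell_symbols_def)

text \<open>Enforces the end-marker condition of \<open>well_formed\<close> for whatever move
  \<open>nxt\<close> proposes.\<close>

fun clamp :: "'a input_symbol \<Rightarrow> move \<Rightarrow> move" where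
  "clamp LeftEnd MoveLeft = Stay"
| "clamp RightEnd MoveRight = Stay"
| "clamp _ d = d"

lemma clamp_LeftEnd [simp]: "clamp LeftEnd d \<noteq> MoveLeft"
  and clamp_RightEnd [simp]: "clamp RightEnd d \<noteq> MoveRight"
  by (cases d; simp)+

text \<open>Separates control from arithmetic: \<open>nxt\<close> is consulted once per sweep, on
  the blank left of the cells, and learns about the work tape only through the two flags of that
  sweep.\<close>

locale sweep_machine =
  fixes op_of :: "'q::finite \<Rightarrow> bool input_symbol \<Rightarrow> sweep_op"
    and nxt :: "'q \<Rightarrow> bool input_symbol \<Rightarrow> bool \<times> bool \<Rightarrow> ('q \<times> move) pmf"
    and q_init q_acc q_rej :: 'q
  assumes acc_neq_rej: "q_acc \<noteq> q_rej"
begin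

text \<open>The first component of a state is the direction, \<open>True\<close> for right. The
  blanks at both ends of the cells turn the head; the control \<open>q\<close> and the input head
  change only at the left one.\<close>

fun transition :: "bool \<times> 'q \<times> bool \<times> bool \<Rightarrow> bool input_symbol \<Rightarrow> nat list option \<Rightarrow>
    ((bool \<times> 'q \<times> bool \<times> bool) \<times> nat list option \<times> move \<times> move) pmf" where
  "transition (True, q, s) \<sigma> (Some v) = return_pmf
     (let (s', v') = rewrite_right (op_of q \<sigma>) s v in ((True, q, s'), Some v', Stay, MoveRight))"
| "transition (True, q, s) \<sigma> None = return_pmf
     ((False, q, s), extension (op_of q \<sigma>) s, Stay, MoveLeft)"
| "transition (False, q, s) \<sigma> (Some v) = return_pmf
     ((False, q, s), Some (rewrite_left (op_of q \<sigma>) s v), Stay, MoveLeft)"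
| "transition (False, q, s) \<sigma> None = map_pmf
     (\<lambda>(q', d). ((True, q', True, True), None, clamp \<sigma> d, MoveRight)) (nxt q \<sigma> s)"

text \<open>Every sweep starts to the right with both flags \<open>True\<close>, so a control state
  is always entered through this one machine state.\<close>

definition code :: "'q \<Rightarrow> nat" where
  "code q = to_nat (True, q, True, True)"

definition machine :: "bool ptm" where
  "machine =
     \<lparr>states = range (to_nat :: bool \<times> 'q \<times> bool \<times> bool \<Rightarrow> nat),
      work_symbols = to_nat ` cell_symbols,
      blank = to_nat (None :: nat list option),
      initial = code q_init, accepting = code q_acc, rejecting = code q_rej,
      trans = (\<lambda>q \<sigma> \<gamma>. map_pmf (\<lambda>(q', v, d, d'). (to_nat q', to_nat v, d, d'))
        (transition (from_nat q) \<sigma> (from_nat \<gamma>)))\<rparr>"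

lemma transition_set:
  assumes "(q', v', d, d') \<in> set_pmf (transition q \<sigma> v)" "v \<in> cell_symbols"
  shows "v' \<in> cell_symbols \<and> (\<sigma> = LeftEnd \<longrightarrow> d \<noteq> MoveLeft) \<and> (\<sigma> = RightEnd \<longrightarrow> d \<noteq> MoveRight)"
  using assms rewrite_right_symbols rewrite_left_symbols extension_symbols
  by (cases "(q, \<sigma>, v)" rule: transition.cases)
    (auto simp: split_beta cell_symbols_def[THEN eqset_imp_iff, of None])

lemma well_formed_machine: "well_formed machine"
proof -
  have "finite (states machine)" "finite (work_symbols machine)"
    by (simp_all add: machine_def finite_cell_symbols)
  moreover have "accepting machine \<noteq> rejecting machine"
    using acc_neq_rej by (simp add: machine_def code_def)
  moreover have "blank machine \<in> work_symbols machine"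
    by (simp add: machine_def cell_symbols_def)
  moreover have "{initial machine, accepting machine, rejecting machine} \<subseteq> states machine"
    by (auto simp: machine_def code_def)
  moreover have "q' \<in> states machine \<and> \<gamma>' \<in> work_symbols machine \<and>
      (\<sigma> = LeftEnd \<longrightarrow> d \<noteq> MoveLeft) \<and> (\<sigma> = RightEnd \<longrightarrow> d \<noteq> MoveRight)"
    if "q \<in> states machine" "\<gamma> \<in> work_symbols machine"
      "(q', \<gamma>', d, d') \<in> set_pmf (trans machine q \<sigma> \<gamma>)" for q \<sigma> \<gamma> q' \<gamma>' d d'
  proof -
    have "q \<in> range (to_nat :: bool \<times> 'q \<times> bool \<times> bool \<Rightarrow> nat)" "\<gamma> \<in> to_nat ` cell_symbols"
      using that(1,2) by (simp_all add: machine_def)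
    then obtain p :: "bool \<times> 'q \<times> bool \<times> bool" and v
      where "q = to_nat p" "\<gamma> = to_nat v" "v \<in> cell_symbols" by blast
    with that(3) obtain p' v' where "q' = to_nat p'" "\<gamma>' = to_nat v'"
      and "(p', v', d, d') \<in> set_pmf (transition p \<sigma> v)"
      by (auto simp: machine_def)
    with transition_set[OF this(3) \<open>v \<in> _\<close>] show ?thesis
      by (auto simp: machine_def)
  qed
  ultimately show ?thesis
    unfolding well_formed_def by blast
qed

definition tape :: "nat list list \<Rightarrow> int \<Rightarrow> nat" where
  "tape vs z = to_nat (if 0 \<le> z \<and> z < int (length vs) then Some (vs ! nat z) else None)"

definition config_at :: "bool \<times> 'q \<times> bool \<times> bool \<Rightarrow> int \<Rightarrow> int \<Rightarrow> nat list list \<Rightarrow> int set \<Rightarrow> config" where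
  "config_at q i z vs V =
     \<lparr>state = to_nat q, input_pos = i, work_pos = z, work_tape = tape vs, visited = V\<rparr>"

lemma initial_config_machine: "initial_config machine = config_at (True, q_init, True, True) 0 0 [] {0}"
  by (auto simp: initial_config_def machine_def config_at_def tape_def code_def)

lemma tape_update:
  "z = int (length pre) \<Longrightarrow> (tape (pre @ v # post))(z := to_nat (Some v')) = tape (pre @ v' # post)"
  by (auto simp: tape_def fun_eq_iff nth_append nth_Cons')

lemma tape_append: "(tape vs)(int (length vs) := to_nat (Some v)) = tape (vs @ [v])"
  by (auto simp: tape_def fun_eq_iff nth_append)

context
  fixes x :: "bool list" and T :: "config set"
  assumes T: "absorbing machine x T"
begin

abbreviation V where "V \<equiv> hit machine x T"

lemma hit_transition:
  assumes "q \<noteq> q_acc" "q \<noteq> q_rej"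
  shows "V (config_at (r, q, s) i z vs W) =
    measure_pmf.expectation (transition (r, q, s) (input_at x i)
        (if 0 \<le> z \<and> z < int (length vs) then Some (vs ! nat z) else None))
      (\<lambda>(q', v, d, d'). V \<lparr>state = to_nat q', input_pos = i + offset d, work_pos = z + offset d',
        work_tape = (tape vs)(z := to_nat v), visited = insert (z + offset d') W\<rparr>)"
  using assms
  by (subst hit_step[OF T])
    (simp add: config_at_def step_def machine_def code_def apply_move_def case_prod_unfold tape_def
      cong del: if_weak_cong)

lemma hit_right_pass:
  assumes "q \<noteq> q_acc" "q \<noteq> q_rej"
  shows "V (config_at (True, q, s) i (int (length pre)) (pre @ vs) W) =
    V (config_at (True, q, fst (sweep_right (op_of q (input_at x i)) s vs)) i
        (int (length pre + length vs)) (pre @ snd (sweep_right (op_of q (input_at x i)) s vs))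
        (W \<union> {int (length pre)<..int (length pre + length vs)}))"
proof (induction vs arbitrary: pre s W)
  case Nil
  then show ?case by simp
next
  case (Cons v vs)
  obtain s' v' where r: "rewrite_right (op_of q (input_at x i)) s v = (s', v')" by fastforce
  have W: "insert (int (length pre) + 1) (W \<union> {int (length (pre @ [v']))<..int (length (pre @ [v']) + length vs)})
      = W \<union> {int (length pre)<..int (length pre + length (v # vs))}"
    by auto
  have "V (config_at (True, q, s) i (int (length pre)) (pre @ v # vs) W) =
      V (config_at (True, q, s') i (int (length (pre @ [v']))) ((pre @ [v']) @ vs)
          (insert (int (length pre) + 1) W))"
    by (subst hit_transition[OF assms]) (simp add: r config_at_def tape_update add.commute)
  also note Cons.IH
  finally show ?case
    using W by (simp add: r split_beta)
qed

lemma hit_left_pass: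
  assumes "q \<noteq> q_acc" "q \<noteq> q_rej"
  shows "V (config_at (False, q, s) i (int (length vs) - 1) (vs @ post) W) =
    V (config_at (False, q, s) i (- 1) (map (rewrite_left (op_of q (input_at x i)) s) vs @ post)
        (W \<union> {-1..<int (length vs) - 1}))"
proof (induction vs arbitrary: post W rule: rev_induct)
  case Nil
  then show ?case by simp
next
  case (snoc v vs)
  let ?v = "rewrite_left (op_of q (input_at x i)) s v"
  have W: "insert (int (length vs) - 1) W \<union> {-1..<int (length vs) - 1} =
      W \<union> {-1..<int (length (vs @ [v])) - 1}"
    by auto
  have "V (config_at (False, q, s) i (int (length (vs @ [v])) - 1) ((vs @ [v]) @ post) W) =
      V (config_at (False, q, s) i (int (length vs) - 1) (vs @ ?v # post)
          (insert (int (length vs) - 1) W))"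
    by (subst hit_transition[OF assms]) (simp add: config_at_def tape_update)
  also note snoc.IH
  finally show ?case
    unfolding W by simp
qed

definition value_at where
  "value_at q i vs W = V (config_at (True, q, True, True) i 0 vs W)"

text \<open>Right pass, turn, left pass and control step become one macro step. A sweep also scans
  the two neighbouring blanks, hence the cells from -1 to \<open>length vs\<close>, and space is the
  number of cells plus 2.\<close>

lemma value_at_sweep:
  assumes "q \<noteq> q_acc" "q \<noteq> q_rej" and "sweep (op_of q (input_at x i)) vs = (s, vs')"
  shows "value_at q i vs W = measure_pmf.expectation (nxt q (input_at x i) s)
    (\<lambda>(q', d). value_at q' (i + offset (clamp (input_at x i) d)) vs' (W \<union> {-1..int (length vs)}))"
proof -
  let ?p = "op_of q (input_at x i)"
  obtain s' us where us: "sweep_right ?p (True, True) vs = (s', us)"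
    by fastforce
  with assms(3) have [simp]: "s' = s"
    by (simp add: sweep_def)
  let ?ext = "case extension ?p s of None \<Rightarrow> [] | Some v \<Rightarrow> [v]"
  have len: "length (snd (sweep_right p s vs)) = length vs" for p s
    by (induction vs arbitrary: s) (auto simp: split_beta)
  from len[of ?p "(True, True)"] have len: "length us = length vs" by (simp add: us)
  have vs': "vs' = map (rewrite_left ?p s) us @ ?ext"
    using assms(3) by (simp add: sweep_def us)
  have "value_at q i vs W = V (config_at (True, q, s) i (int (length vs)) us (W \<union> {0<..int (length vs)}))"
    unfolding value_at_def using hit_right_pass[OF assms(1,2), of "(True, True)" i "[]" vs W] by (simp add: us)
  also have "\<dots> = V (config_at (False, q, s) i (int (length vs) - 1) (us @ ?ext)
      (insert (int (length vs) - 1) (W \<union> {0<..int (length vs)})))"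
  proof (cases "extension ?p s")
    case None
    have "(tape us)(int (length vs) := to_nat (None :: nat list option)) = tape us"
      by (auto simp: tape_def len)
    then show ?thesis
      by (subst hit_transition[OF assms(1,2)]) (simp add: config_at_def len None)
  next
    case (Some v)
    then show ?thesis
      using tape_append[of us v]
      by (subst hit_transition[OF assms(1,2)]) (simp add: config_at_def len)
  qed
  also have "\<dots> = V (config_at (False, q, s) i (- 1) vs'
      (insert (int (length vs) - 1) (W \<union> {0<..int (length vs)}) \<union> {-1..<int (length vs) - 1}))"
    unfolding vs' using hit_left_pass[OF assms(1,2)] by (simp add: len flip: len)
  also have "\<dots> = measure_pmf.expectation (nxt q (input_at x i) s)
    (\<lambda>(q', d). value_at q' (i + offset (clamp (input_at x i) d)) vs' (W \<union> {-1..int (length vs)}))"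
  proof -
    have "insert 0 (insert (int (length vs) - 1) (W \<union> {0<..int (length vs)}) \<union> {-1..<int (length vs) - 1})
       = W \<union> {-1..int (length vs)}" by auto
    moreover have "(tape vs')(-1 := to_nat (None :: nat list option)) = tape vs'"
      by (auto simp: tape_def)
    ultimately show ?thesis
      by (subst hit_transition[OF assms(1,2)]) (simp add: config_at_def value_at_def case_prod_unfold)
  qed
  finally show ?thesis .
qed

lemma value_at_acc: "value_at q_acc i vs W = indicator T (config_at (True, q_acc, True, True) i 0 vs W)"
  and value_at_rej: "value_at q_rej i vs W = indicator T (config_at (True, q_rej, True, True) i 0 vs W)"
  unfolding value_at_def by (rule hit_halted[OF T]; simp add: config_at_def machine_def code_def)+

lemma value_at_bounds: "0 \<le> value_at q i vs W" "value_at q i vs W \<le> 1"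
  unfolding value_at_def by (rule hit_bounds[OF T])+

end

end

section \<open>Numbers on the work tape\<close>

primrec cells :: "nat \<Rightarrow> nat list \<Rightarrow> nat list list" where
  "cells 0 ns = []"
| "cells (Suc w) ns = map (\<lambda>n. n mod 64) ns # cells w (map (\<lambda>n. n div 64) ns)"

lemma length_cells [simp]: "length (cells w ns) = w"
  by (induction w arbitrary: ns) auto

lemma cells_Suc_right:
  "cells (Suc w) ns = cells w ns @ [map (\<lambda>n. n div 64 ^ w mod 64) ns]"
proof (induction w arbitrary: ns)
  case (Suc w)
  have "cells (Suc (Suc w)) ns = map (\<lambda>n. n mod 64) ns # cells (Suc w) (map (\<lambda>n. n div 64) ns)"
    by (rule cells.simps)
  also note Suc.IH
  finally show ?case by (simp add: o_def div_mult2_eq)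
qed simp

lemma map_cells_zero: "map (\<lambda>v. v[k := 0]) (cells w ns) = cells w (ns[k := 0])"
  by (induction w arbitrary: ns) (simp_all add: map_update)

lemma mod_64_pow_Suc_eq_iff:
  "n mod 64 = m mod 64 \<and> n div 64 mod 64 ^ w = m div 64 mod 64 ^ w \<longleftrightarrow> n mod 64 ^ Suc w = m mod (64 ^ Suc w :: nat)"
    (is "?l \<longleftrightarrow> ?r")
proof
  have split: "n mod (64 * 64 ^ w) = 64 * (n div 64 mod 64 ^ w) + n mod 64" for n :: nat
    by (rule mod_mult2_eq)
  show ?r if ?l
    unfolding power_Suc split[of n] split[of m] using that by (simp only:)
  have "n mod 64 = n mod (64 * 64 ^ w) mod 64" "n div 64 mod 64 ^ w = n mod (64 * 64 ^ w) div 64" for n :: nat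
    unfolding split[of n] by simp_all
  then show ?l if ?r
    using that unfolding power_Suc by metis
qed

lemma carry_iff:
  "((c \<and> n mod 64 = 63) \<and> Suc (n div 64) mod 64 ^ w = 0) = (c \<and> Suc n mod (64 ^ Suc w :: nat) = 0)"
proof -
  have 1: "n mod 64 = 63 \<longleftrightarrow> Suc n mod 64 = 0" and 2: "n mod 64 = 63 \<Longrightarrow> Suc n div 64 = Suc (n div 64)"
    by (simp_all add: mod_Suc div_Suc)
  have 3: "Suc n mod 64 = 0 \<and> Suc n div 64 mod 64 ^ w = 0 \<longleftrightarrow> Suc n mod 64 ^ Suc w = 0"
    using mod_64_pow_Suc_eq_iff[of "Suc n" 0 w] by (simp only: mod_0 div_0)
  show ?thesis
    unfolding 3[symmetric] 1[symmetric] using 2 by (cases "n mod 64 = 63") (simp_all only: simp_thms)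
qed

lemma add_of_bool_div_64: "(n + of_bool c) div 64 = n div 64 + of_bool (c \<and> n mod 64 = 63)" for n :: nat
  by (cases c) (auto simp: div_Suc mod_Suc)

text \<open>The incoming flags are arbitrary so that the induction can continue in the middle of a
  number: carry and agreement so far are handed to the quotients by 64.\<close>

lemma sweep_right_Tick:
  assumes "k < length ns" "0 < k"
  shows "sweep_right (Tick k) (c, e) (cells w ns) =
    ((c \<and> Suc (ns ! k) mod 64 ^ w = 0, e \<and> (ns ! k + of_bool c) mod 64 ^ w = ns ! 0 mod 64 ^ w),
     cells w (ns[k := ns ! k + of_bool c]))"
  using assms
proof (induction w arbitrary: ns c e)
  case (Suc w)
  define n where "n = ns ! k"
  define c' where "c' \<longleftrightarrow> c \<and> n mod 64 = 63"
  define e' where "e' \<longleftrightarrow> e \<and> (n + of_bool c) mod 64 = ns ! 0 mod 64"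
  have k: "k < length ns" "0 < length ns" using Suc.prems by auto
  have r: "rewrite_right (Tick k) (c, e) (map (\<lambda>n. n mod 64) ns) =
      ((c', e'), map (\<lambda>n. n mod 64) (ns[k := n + of_bool c]))"
    using k by (simp add: Let_def c'_def e'_def n_def map_update mod_add_left_eq)
  have d: "map (\<lambda>n. n div 64) (ns[k := n + of_bool c]) = (map (\<lambda>n. n div 64) ns)[k := n div 64 + of_bool c']"
    unfolding c'_def by (simp only: map_update add_of_bool_div_64)
  have 1: "(c' \<and> Suc (n div 64) mod 64 ^ w = 0) = (c \<and> Suc n mod 64 ^ Suc w = 0)"
    unfolding c'_def by (rule carry_iff)
  have 2: "(e' \<and> (n div 64 + of_bool c') mod 64 ^ w = ns ! 0 div 64 mod 64 ^ w) =
      (e \<and> (n + of_bool c) mod 64 ^ Suc w = ns ! 0 mod 64 ^ Suc w)"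
    unfolding c'_def e'_def by (simp only: flip: add_of_bool_div_64 mod_64_pow_Suc_eq_iff) blast
  have "sweep_right (Tick k) (c', e') (cells w (map (\<lambda>n. n div 64) ns)) =
    ((c' \<and> Suc (n div 64) mod 64 ^ w = 0, e' \<and> (n div 64 + of_bool c') mod 64 ^ w = ns ! 0 div 64 mod 64 ^ w),
     cells w ((map (\<lambda>n. n div 64) ns)[k := n div 64 + of_bool c']))"
    using Suc.IH[of "map (\<lambda>n. n div 64) ns" c' e'] Suc.prems k by (simp add: n_def)
  then show ?case
    unfolding 1 2 by (simp only: cells.simps sweep_right.simps r[unfolded n_def] d[unfolded n_def] n_def prod.case Let_def snd_conv)
qed simp

lemma sweep_right_Inc:
  assumes "ns \<noteq> []"
  shows "sweep_right Inc (c, e) (cells w ns) =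
    ((c \<and> Suc (ns ! 0) mod 64 ^ w = 0, e), cells w (ns[0 := ns ! 0 + of_bool c]))"
  using assms
proof (induction w arbitrary: ns c e)
  case (Suc w)
  define n where "n = ns ! 0"
  define c' where "c' \<longleftrightarrow> c \<and> n mod 64 = 63"
  have r: "rewrite_right Inc (c, e) (map (\<lambda>n. n mod 64) ns) =
      ((c', e), map (\<lambda>n. n mod 64) (ns[0 := n + of_bool c]))"
    using Suc.prems by (simp add: c'_def n_def map_update mod_add_left_eq)
  have d: "map (\<lambda>n. n div 64) (ns[0 := n + of_bool c]) = (map (\<lambda>n. n div 64) ns)[0 := n div 64 + of_bool c']"
    unfolding c'_def by (simp only: map_update add_of_bool_div_64)
  have 1: "(c' \<and> Suc (n div 64) mod 64 ^ w = 0) = (c \<and> Suc n mod 64 ^ Suc w = 0)"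
    unfolding c'_def by (rule carry_iff)
  have "sweep_right Inc (c', e) (cells w (map (\<lambda>n. n div 64) ns)) =
    ((c' \<and> Suc (n div 64) mod 64 ^ w = 0, e), cells w ((map (\<lambda>n. n div 64) ns)[0 := n div 64 + of_bool c']))"
    using Suc.IH[of "map (\<lambda>n. n div 64) ns" c' e] Suc.prems by (simp add: n_def)
  then show ?case
    unfolding 1 by (simp only: cells.simps sweep_right.simps r[unfolded n_def] d[unfolded n_def] n_def prod.case Let_def snd_conv)
qed simp

lemma sweep_Nop: "sweep Nop vs = ((True, True), vs)"
proof -
  have "sweep_right Nop s vs = (s, vs)" for s
    by (induction vs) auto
  moreover have "rewrite_left Nop s = (\<lambda>v. v)" for s
    by (auto simp: fun_eq_iff)
  ultimately show ?thesis by (simp add: sweep_def)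
qed

lemma rewrite_left_unfold:
  "rewrite_left (Tick k) s = (if snd s then (\<lambda>v. v[k := 0]) else (\<lambda>v. v))"
  "rewrite_left Test s = (\<lambda>v. v[1 := 0])"
  "rewrite_left Inc s = (\<lambda>v. v)" "rewrite_left Read s = (\<lambda>v. v)"
  by (cases s; auto)+

text \<open>The incremented number is at most number 0, which fits into \<open>w\<close> digits. So
  agreement modulo \<open>64 ^ w\<close> is equality, and the reset is reduction modulo number
  0.\<close>

lemma sweep_Tick:
  assumes "k < length ns" "0 < k" "ns ! k < ns ! 0" "ns ! 0 < 64 ^ w"
  shows "\<exists>b. sweep (Tick k) (cells w ns) = ((b, Suc (ns ! k) = ns ! 0), cells w (ns[k := Suc (ns ! k) mod ns ! 0]))"
  using assms
  by (auto simp: sweep_def sweep_right_Tick map_cells_zero rewrite_left_unfold)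

text \<open>\<open>w\<close> is the number of base-64 digits of \<open>i\<close>, with no digits for
  0. This ties space to the size of the stored number.\<close>

definition tight :: "nat \<Rightarrow> nat \<Rightarrow> bool" where
  "tight w i \<longleftrightarrow> i < 64 ^ w \<and> (w > 0 \<longrightarrow> 64 ^ (w - 1) \<le> i)"

lemma sweep_Inc:
  assumes "tight w i"
  obtains s w' where "sweep Inc (cells w [i, 0, 0, 0]) = (s, cells w' [Suc i, 0, 0, 0])" "tight w' (Suc i)" "w' \<ge> w"
proof (cases "Suc i = 64 ^ w")
  case True
  \<comment> \<open>All digits were 63 and turned to 0; the extension supplies the leading digit of
    \<open>64 ^ w\<close>.\<close>
  have "cells w [Suc i, 0, 0, 0] @ [[1, 0, 0, 0]] = cells (Suc w) [Suc i, 0, 0, 0]"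
    unfolding cells_Suc_right by (simp add: True)
  then show ?thesis
    using True by (intro that[of "(True, True)" "Suc w"]) (auto simp: sweep_def sweep_right_Inc tight_def rewrite_left_unfold simp del: cells.simps)
next
  case False
  with assms have "Suc i < 64 ^ w" by (auto simp: tight_def)
  then show ?thesis
    using assms by (intro that[of "(False, True)" w]) (auto simp: sweep_def sweep_right_Inc tight_def rewrite_left_unfold simp del: cells.simps)
qed

text \<open>Propositional core of the induction for \<open>Test\<close>. \<open>a0\<close>,
  \<open>a1\<close>: the lowest digit is 0, 1; \<open>b0\<close>: the quotient by 64 is 0;
  \<open>c0\<close>, \<open>c1\<close>: the number is 0, 1; \<open>E\<close>, \<open>C\<close>: the
  quotient, the number is a power of 64.\<close>

lemma test_digit_bool:
  assumes "(a0 \<and> b0) = c0" "C = (c1 \<or> a0 \<and> E)" "(a1 \<and> b0) = c1" "\<not> (a0 \<and> a1)"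
  shows "((z \<and> a0) \<and> b0) = (z \<and> c0) \<and>
    ((e \<and> (a0 \<or> z \<and> a1)) \<and> (b0 \<or> (z \<and> a0) \<and> E)) = (e \<and> (c0 \<or> z \<and> C))"
  using assms by blast

lemma sweep_right_Test:
  "ns \<noteq> [] \<Longrightarrow> ns ! 0 < 64 ^ w \<Longrightarrow> sweep_right Test (z, e) (cells w ns) =
    ((z \<and> ns ! 0 = 0, e \<and> (ns ! 0 = 0 \<or> z \<and> (\<exists>k. ns ! 0 = 64 ^ k))), cells w ns)"
proof (induction w arbitrary: ns z e)
  case (Suc w)
  let ?n = "ns ! 0"
  have "?n div 64 < 64 ^ w" using Suc.prems by (simp add: less_mult_imp_div_less mult.commute)
  have 0: "?n mod 64 = 0 \<and> ?n div 64 = 0 \<longleftrightarrow> ?n = 0" by (auto simp: div_eq_0_iff)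
  have 1: "(\<exists>k. n = 64 ^ k) \<longleftrightarrow> n = 1 \<or> n mod 64 = 0 \<and> (\<exists>k. n div 64 = 64 ^ k)" (is "?l = ?r") for n :: nat
  proof
    assume ?l
    then obtain k where "n = 64 ^ k" ..
    then show ?r by (cases k) auto
  next
    assume ?r
    then show ?l
    proof
      assume "n mod 64 = 0 \<and> (\<exists>k. n div 64 = 64 ^ k)"
      then obtain k where "n = 64 ^ Suc k" by auto
      then show ?l ..
    qed (auto intro: exI[of _ 0])
  qed
  have 2: "?n mod 64 = 1 \<and> ?n div 64 = 0 \<longleftrightarrow> ?n = 1" by (auto simp: div_eq_0_iff)
  have 3: "\<not> (?n mod 64 = 0 \<and> ?n mod 64 = 1)" by (metis zero_neq_one)
  have r: "rewrite_right Test (z, e) (map (\<lambda>n. n mod 64) ns) =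
      ((z \<and> ?n mod 64 = 0, e \<and> (?n mod 64 = 0 \<or> z \<and> ?n mod 64 = 1)), map (\<lambda>n. n mod 64) ns)"
    using Suc.prems by simp
  have IH: "sweep_right Test (z, e) (cells w (map (\<lambda>n. n div 64) ns)) =
    ((z \<and> ?n div 64 = 0, e \<and> (?n div 64 = 0 \<or> z \<and> (\<exists>k. ?n div 64 = 64 ^ k))),
      cells w (map (\<lambda>n. n div 64) ns))" for z e
    using Suc.IH[of "map (\<lambda>n. n div 64) ns" z e] Suc.prems \<open>?n div 64 < 64 ^ w\<close> by simp
  show ?case
    unfolding cells.simps sweep_right.simps r IH prod.case Let_def prod.inject
    using test_digit_bool[OF 0 1 2 3, of z e] by simp
qed simp

lemma sweep_Test:
  assumes "tight w i" "i > 0"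
  shows "sweep Test (cells w [i, n, 0, 0]) = ((False, \<exists>k. i = 64 ^ k), cells w [i, 0, 0, 0])"
  using assms by (simp add: sweep_def sweep_right_Test tight_def map_cells_zero rewrite_left_unfold)

text \<open>The only nonzero digit of \<open>64 ^ k\<close> is in the last cell. So the last cell
  where number 0 has digit 0 holds the top digit of \<open>h\<close>, and this is at least 32 iff
  \<open>h\<close> is at least half of \<open>64 ^ k\<close>. For \<open>k = 0\<close> there is no
  such cell.\<close>

lemma sweep_right_Read:
  "h < 64 ^ k \<Longrightarrow> \<exists>e'. sweep_right Read (b, e) (cells (Suc k) [64 ^ k, 0, 0, h]) =
    ((if k = 0 then b else 2 * h \<ge> 64 ^ k, e'), cells (Suc k) [64 ^ k, 0, 0, h])"
proof (induction k arbitrary: b h e)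
  case (Suc k)
  have h: "h div 64 < 64 ^ k" using Suc.prems by (simp add: less_mult_imp_div_less mult.commute)
  obtain e' where IH: "sweep_right Read (h mod 64 \<ge> 32, e) (cells (Suc k) [64 ^ k, 0, 0, h div 64]) =
    ((if k = 0 then h mod 64 \<ge> 32 else 2 * (h div 64) \<ge> 64 ^ k, e'), cells (Suc k) [64 ^ k, 0, 0, h div 64])"
    using Suc.IH[OF h] by blast
  have c: "cells (Suc (Suc k)) [64 ^ Suc k, 0, 0, h] = [0, 0, 0, h mod 64] # cells (Suc k) [64 ^ k, 0, 0, h div 64]"
    by (subst cells.simps(2)) (simp del: cells.simps)
  have r: "rewrite_right Read (b, e) [0, 0, 0, h mod 64] = ((h mod 64 \<ge> 32, e), [0, 0, 0, h mod 64])"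
    by simp
  have "(if k = 0 then h mod 64 \<ge> 32 else 2 * (h div 64) \<ge> 64 ^ k) = (2 * h \<ge> 64 ^ Suc k)"
  proof (cases k)
    case 0
    then have "h < 64" using Suc.prems by simp
    with 0 show ?thesis by auto
  next
    case (Suc j)
    have "2 * (h div 64) \<ge> 64 * m \<longleftrightarrow> 2 * h \<ge> 64 * (64 * m)" for m
      using less_eq_div_iff_mult_less_eq[of 64 "32 * m" h] by linarith
    with Suc show ?thesis by simp
  qed
  with IH show ?case
    unfolding c sweep_right.simps r prod.case Let_def by (simp del: cells.simps)
qed auto

lemma sweep_Read:
  assumes "h < 64 ^ k" "k > 0"
  shows "\<exists>e. sweep Read (cells (Suc k) [64 ^ k, 0, 0, h]) = ((2 * h \<ge> 64 ^ k, e), cells (Suc k) [64 ^ k, 0, 0, h])"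
  using sweep_right_Read[OF assms(1), of True True] assms(2)
  by (auto simp: sweep_def rewrite_left_unfold simp del: cells.simps)

lemma tight_pow: "tight w (64 ^ k) \<Longrightarrow> w = Suc k"
proof -
  assume w: "tight w (64 ^ k)"
  then have "k < w" by (simp add: tight_def)
  moreover have "w - 1 \<le> k" using w \<open>k < w\<close> by (simp add: tight_def)
  ultimately show "w = Suc k" by simp
qed

section \<open>The machine\<close>

datatype mode = Acc_next | Acc_last | Rej_fst | Rej_snd | Rej_last

text \<open>
  In \<open>Block m m'\<close> the machine reads the zeros of a block; \<open>m\<close> and \<open>m'\<close> are the modes of the pairs
  that the block forms with its left and right neighbour. The mode of the second pair is guessed
  on entering the block, \<open>Acc_last\<close> and \<open>Rej_last\<close> being the guess that there is no right
  neighbour. A rejecting pass charges either only the first or only the second block of a pair.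
\<close>

datatype ctl = Start | First mode | Second mode | Header mode | Block mode mode | Back
  | Increment | Rewind | Scan bool | Skip bool | Check | Toss | Head | Inner | Outer | Decide
  | Accept | Reject

instance mode :: finite
proof
  have "UNIV = {Acc_next, Acc_last, Rej_fst, Rej_snd, Rej_last}"
    using mode.exhaust by blast
  then show "finite (UNIV :: mode set)" by (metis finite.emptyI finite.insertI)
qed

instance ctl :: finite
proof
  have "UNIV = {Start, Back, Increment, Rewind, Check, Toss, Head, Inner, Outer, Decide, Accept, Reject}
    \<union> range First \<union> range Second \<union> range Header \<union> range Scan \<union> range Skip
    \<union> range (\<lambda>(m, m'). Block m m')" (is "_ = ?A")
  proof (intro equalityI subsetI)
    fix q :: ctl show "q \<in> ?A" by (cases q) auto
  qed simp
  moreover have "finite ?A" by (intro finite_UnI finite_imageI finite_insert[THEN iffD2] finite.emptyI) simp_all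
  ultimately show "finite (UNIV :: ctl set)" by metis
qed

definition coin :: "real \<Rightarrow> 'b \<Rightarrow> 'b \<Rightarrow> 'b pmf" where
  "coin r y z = map_pmf (\<lambda>b. if b then y else z) (bernoulli_pmf r)"

lemma expectation_coin:
  "0 \<le> r \<Longrightarrow> r \<le> 1 \<Longrightarrow> measure_pmf.expectation (coin r y z) f = r * f y + (1 - r) * (f z :: real)"
  by (simp add: coin_def mult.commute)

text \<open>A pair that violates doubling raises the ratio of rejecting to accepting weight by at
  least \<open>1 / (2 * \<theta>) = 2 ^ 10\<close>, the 2 coming from the arithmetic mean. Against
  the ratio 32 : 1 of the final coins this leaves an error of
  \<open>32 / (32 + 2 ^ 10) = 1 / 33\<close>.\<close>

definition \<theta> :: real where "\<theta> = 1 / 2 ^ 11"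

text \<open>Exponents of \<theta> paid per zero by the left block of a pair; \<open>snd_cost\<close>
  is for the right block. The totals \<open>2 * m + m'\<close>, \<open>4 * m\<close> and
  \<open>2 * m'\<close> coincide exactly when \<open>m' = 2 * m\<close>.\<close>

fun fst_cost :: "mode \<Rightarrow> nat" where
  "fst_cost Acc_next = 2"
| "fst_cost Rej_fst = 4"
| "fst_cost _ = 0"

fun snd_cost :: "mode \<Rightarrow> nat" where
  "snd_cost Acc_next = 1"
| "snd_cost Rej_snd = 2"
| "snd_cost _ = 0"

fun op_of :: "ctl \<Rightarrow> bool input_symbol \<Rightarrow> sweep_op" where
  "op_of Increment _ = Inc"
| "op_of (Scan _) (Sym True) = Tick 1"
| "op_of Check _ = Test"
| "op_of Head _ = Tick 3"
| "op_of Inner _ = Tick 1"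
| "op_of Outer _ = Tick 2"
| "op_of Decide _ = Read"
| "op_of _ _ = Nop"

text \<open>The leading 0, read in \<open>First\<close>, acts as a block of length 1. At each header
  the last block is guessed with probability 1/3 in both kinds of pass, so guessing does not bias
  their ratio. In \<open>Scan e\<close>, \<open>e\<close> tells whether the last counted block
  completed a multiple of the modulus; \<open>Skip\<close> passes the header symbol
  \<open>a\<close>, which must not be counted when it is 1.\<close>

fun nxt :: "bool \<Rightarrow> real \<Rightarrow> ctl \<Rightarrow> bool input_symbol \<Rightarrow> bool \<times> bool \<Rightarrow> (ctl \<times> move) pmf" where
  "nxt a p Start \<sigma> s = map_pmf (\<lambda>m. (First m, MoveRight)) (pmf_of_set {Acc_next, Rej_fst, Rej_snd})"
| "nxt a p (First m) \<sigma> s =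
     (if \<sigma> = Sym False then coin (\<theta> ^ fst_cost m) (Second m, MoveRight) (Back, Stay)
      else return_pmf (Reject, Stay))"
| "nxt a p (Second m) \<sigma> s =
     return_pmf (if \<sigma> = Sym True then (Header m, MoveRight) else (Reject, Stay))"
| "nxt a p (Header m) \<sigma> s =
     (if \<sigma> \<noteq> Sym a then return_pmf (Reject, Stay)
      else if m = Acc_next then coin (2 / 3) (Block m Acc_next, MoveRight) (Block m Acc_last, MoveRight)
      else map_pmf (\<lambda>m'. (Block m m', MoveRight)) (pmf_of_set {Rej_fst, Rej_snd, Rej_last}))"
| "nxt a p (Block m m') \<sigma> s =
     (if \<sigma> = Sym False then
        coin (\<theta> ^ (snd_cost m + fst_cost m')) (Block m m', MoveRight) (Back, Stay)
      else if \<sigma> = Sym True then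
        return_pmf (if m' \<in> {Acc_last, Rej_last} then (Back, Stay) else (Header m', MoveRight))
      else if m' = Acc_last then return_pmf (Increment, Stay)
      else if m' = Rej_last then coin (1 / 64) (Reject, Stay) (Back, Stay)
      else return_pmf (Back, Stay))"
| "nxt a p Back \<sigma> s = return_pmf (if \<sigma> = LeftEnd then (Start, Stay) else (Back, MoveLeft))"
| "nxt a p Increment \<sigma> s = return_pmf (Rewind, Stay)"
| "nxt a p Rewind \<sigma> s = return_pmf (if \<sigma> = LeftEnd then (Scan False, MoveRight) else (Rewind, MoveLeft))"
| "nxt a p (Scan e) \<sigma> s = return_pmf
     (if \<sigma> = RightEnd then (if e then Increment else Check, Stay)
      else if \<sigma> = Sym True then (Skip (snd s), MoveRight) else (Scan e, MoveRight))"
| "nxt a p (Skip e) \<sigma> s = return_pmf (Scan e, MoveRight)"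
| "nxt a p Check \<sigma> s = return_pmf (if snd s then Toss else Reject, Stay)"
| "nxt a p Toss \<sigma> s = coin p (Head, Stay) (Inner, Stay)"
| "nxt a p Head \<sigma> s = return_pmf (Inner, Stay)"
| "nxt a p Inner \<sigma> s = return_pmf (if snd s then Outer else Toss, Stay)"
| "nxt a p Outer \<sigma> s = return_pmf (if snd s then Decide else Toss, Stay)"
| "nxt a p Decide \<sigma> s = return_pmf (if fst s then Accept else Reject, Stay)"
| "nxt a p _ \<sigma> s = return_pmf (Reject, Stay)"

interpretation log_machine: sweep_machine op_of "nxt a p" Start Accept Reject for a p
  by unfold_locales simp

abbreviation log_machine :: "bool \<Rightarrow> real \<Rightarrow> bool ptm" where
  "log_machine \<equiv> log_machine.machine"

locale log_machine_run =
  fixes a :: bool and p :: real and x :: "bool list" and T :: "config set"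
  assumes p01: "0 \<le> p" "p \<le> 1"
    and T: "absorbing (log_machine a p) x T"
begin

definition val :: "ctl \<Rightarrow> int \<Rightarrow> nat list list \<Rightarrow> int set \<Rightarrow> real" where
  "val = log_machine.value_at a p x T"

lemma val_step:
  assumes "input_at x i = \<sigma>" "sweep (op_of q \<sigma>) vs = (s, vs')" "q \<noteq> Accept" "q \<noteq> Reject"
  shows "val q i vs W = measure_pmf.expectation (nxt a p q \<sigma> s)
    (\<lambda>(q', d). val q' (i + offset (clamp \<sigma> d)) vs' (W \<union> {-1..int (length vs)}))"
  using log_machine.value_at_sweep[OF T assms(3,4), of i vs s vs' W] assms
  by (simp add: val_def)

lemma val_bounds: "0 \<le> val q i vs W" "val q i vs W \<le> 1"
  unfolding val_def by (rule log_machine.value_at_bounds[OF T])+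

lemma sweep_Nop_Nil: "sweep Nop [] = ((True, True), [])"
  by (rule sweep_Nop)

text \<open>The first sweep scans both cells of \<open>{-1..0}\<close> anyway. Adding them at once
  keeps \<open>visited\<close> constant throughout the format check, which leaves the tape
  empty.\<close>

lemma hit_initial:
  "hit (log_machine a p) x T (initial_config (log_machine a p)) = val Start 0 [] {-1..0}"
proof -
  have "hit (log_machine a p) x T (initial_config (log_machine a p)) = val Start 0 [] {0}"
    by (simp add: val_def log_machine.value_at_def[OF T] log_machine.initial_config_machine)
  also have "{0} \<union> {-1..0} = {-1..0} \<union> {-1..0 :: int}" by auto
  then have "val Start 0 [] {0} = val Start 0 [] {-1..0}"
    by (simp add: val_step[OF refl, of Start] sweep_Nop_Nil)
  finally show ?thesis .
qed

end

section \<open>Checking the format\<close>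

definition blocks :: "bool \<Rightarrow> nat list \<Rightarrow> bool list" where
  "blocks a ms = concat (map (\<lambda>m. True # a # replicate m False) ms)"

lemma blocks_simps [simp]:
  "blocks a [] = []" "blocks a (m # ms) = True # a # replicate m False @ blocks a ms"
  by (simp_all add: blocks_def)

text \<open>What a pass pays for neighbouring pairs, times the probabilities 2/3 and 1/3 of guessing
  correctly that a block is followed by another or is last. \<open>weight_rej\<close> adds up the
  two equally likely rejecting modes of a pair.\<close>

fun weight_acc :: "nat list \<Rightarrow> real" where
  "weight_acc (m # m' # ms) = 2 / 3 * \<theta> ^ (2 * m + m') * weight_acc (m' # ms)"
| "weight_acc _ = 1 / 3"

fun weight_rej :: "nat list \<Rightarrow> real" where
  "weight_rej (m # m' # ms) = 1 / 3 * (\<theta> ^ (4 * m) + \<theta> ^ (2 * m')) * weight_rej (m' # ms)"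
| "weight_rej _ = 1 / 3"

fun doubling :: "nat list \<Rightarrow> bool" where
  "doubling (m # m' # ms) \<longleftrightarrow> m' = 2 * m \<and> doubling (m' # ms)"
| "doubling _ \<longleftrightarrow> True"

lemma theta_bounds: "0 < \<theta>" "\<theta> < 1" "\<theta> ^ k \<le> 1" "0 < \<theta> ^ k"
  by (simp_all add: \<theta>_def power_le_one)

lemma weight_pos: "0 < weight_acc ms" "0 < weight_rej ms"
  by (induction ms rule: weight_acc.induct) (simp_all add: theta_bounds add_pos_pos)

lemma theta_amgm: "2 * \<theta> ^ (u + v) \<le> \<theta> ^ (2 * u) + \<theta> ^ (2 * v)"
  using zero_le_power2[of "\<theta> ^ u - \<theta> ^ v"]
  by (simp add: power2_diff power_mult[symmetric] mult_ac power_add)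

text \<open>The smaller exponent decides: its term alone exceeds \<open>\<theta> ^ (u + v)\<close>
  by a factor \<open>1 / \<theta>\<close> for each unit of difference between \<open>u\<close> and
  \<open>v\<close>.\<close>

lemma theta_gap:
  assumes "u \<noteq> v"
  shows "2 ^ 11 * \<theta> ^ (u + v) \<le> \<theta> ^ (2 * u) + \<theta> ^ (2 * v)"
proof -
  have *: "2 ^ 11 * \<theta> ^ (u + v) \<le> \<theta> ^ (2 * u)" if "u < v" for u v
  proof -
    obtain d where "v = u + Suc d" using \<open>u < v\<close> less_iff_Suc_add by auto
    then have "2 ^ 11 * \<theta> ^ (u + v) = \<theta> ^ d * \<theta> ^ (2 * u)"
      by (simp add: power_add mult_2) (simp add: \<theta>_def)
    also have "\<dots> \<le> \<theta> ^ (2 * u)"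
      using theta_bounds by (simp add: mult_left_le_one_le)
    finally show ?thesis .
  qed
  from assms consider "u < v" | "v < u" by linarith
  then show ?thesis
  proof cases
    case 1
    then show ?thesis using *[OF 1] theta_bounds(4)[of "2 * v"] by linarith
  next
    case 2
    then show ?thesis using *[OF 2] theta_bounds(4)[of "2 * u"] unfolding add.commute[of v u] by linarith
  qed
qed

lemma weight_acc_le_rej: "weight_acc ms \<le> weight_rej ms"
proof (induction ms rule: weight_acc.induct)
  case (1 m m' ms)
  have "2 / 3 * \<theta> ^ (2 * m + m') \<le> 1 / 3 * (\<theta> ^ (4 * m) + \<theta> ^ (2 * m'))"
    using theta_amgm[of "2 * m" m'] by simp
  from mult_mono[OF this 1] show ?case
    using weight_pos(1)[of "m' # ms"] theta_bounds(4) by (simp add: less_imp_le add_nonneg_nonneg)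
qed auto

lemma weight_doubling: "doubling ms \<Longrightarrow> weight_acc ms = weight_rej ms"
  by (induction ms rule: weight_acc.induct) auto

text \<open>The first violated pair contributes \<open>2 ^ 11 / 2\<close>; all other pairs
  contribute at least 1 by the inequality of the means.\<close>

lemma weight_not_doubling: "\<not> doubling ms \<Longrightarrow> 2 ^ 10 * weight_acc ms \<le> weight_rej ms"
proof (induction ms rule: weight_acc.induct)
  case (1 m m' ms)
  note less_imp_le[OF weight_pos(1), simp] less_imp_le[OF weight_pos(2), simp] less_imp_le[OF theta_bounds(4), simp]
  let ?q = "2 / 3 * \<theta> ^ (2 * m + m')" and ?r = "1 / 3 * (\<theta> ^ (4 * m) + \<theta> ^ (2 * m'))"
  show ?case
  proof (cases "m' = 2 * m")
    case True
    have "?q \<le> ?r"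
      using theta_amgm[of "2 * m" m'] by simp
    moreover have "2 ^ 10 * weight_acc (m' # ms) \<le> weight_rej (m' # ms)"
      using 1 True by simp
    ultimately have "?q * (2 ^ 10 * weight_acc (m' # ms)) \<le> ?r * weight_rej (m' # ms)"
      by (rule mult_mono) (simp_all add: add_nonneg_nonneg)
    then show ?thesis by (simp add: mult_ac)
  next
    case False
    have "2 ^ 10 * ?q \<le> ?r"
      using theta_gap[of "2 * m" m'] False by simp
    then have "(2 ^ 10 * ?q) * weight_acc (m' # ms) \<le> ?r * weight_rej (m' # ms)"
      using weight_acc_le_rej by (rule mult_mono) (simp_all add: add_nonneg_nonneg)
    then show ?thesis by (simp add: mult_ac)
  qed
qed auto

text \<open>Head positions are named by the suffix still to be read, so that the analysis of a pass
  can recurse on the word.\<close>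

lemma input_at_suffix:
  assumes "suffix ys x"
  shows "input_at x (int (length x) - int (length ys) + 1) = (case ys of [] \<Rightarrow> RightEnd | y # _ \<Rightarrow> Sym y)"
  using assms by (auto simp: suffix_def input_at_def nth_append split: list.split)

section \<open>Gains of the random passes\<close>

context log_machine_run
begin

abbreviation v_start :: real where "v_start \<equiv> val Start 0 [] {-1..0}"

abbreviation v_pass :: real where "v_pass \<equiv> val Increment (int (length x) + 1) [] {-1..0}"

text \<open>
  A pass that dies returns to the start, where the gain is 0. Hence reading a symbol that is
  survived with probability \<open>r\<close> multiplies the gain by \<open>r\<close>.
\<close>

definition gain :: "ctl \<Rightarrow> bool list \<Rightarrow> real" where
  "gain q ys = val q (int (length x) - int (length ys) + 1) [] {-1..0} - v_start"

lemma val_step_Nil: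
  assumes "input_at x i = \<sigma>" "op_of q \<sigma> = Nop" "q \<noteq> Accept" "q \<noteq> Reject"
  shows "val q i [] {-1..0} = measure_pmf.expectation (nxt a p q \<sigma> (True, True))
    (\<lambda>(q', d). val q' (i + offset (clamp \<sigma> d)) [] {-1..0})"
  using val_step[OF assms(1) _ assms(3,4), of "[]" "(True, True)" "[]" "{-1..0}"]
  by (simp add: assms(2) sweep_Nop_Nil)

lemma val_Back: "0 \<le> i \<Longrightarrow> i \<le> int (length x) + 1 \<Longrightarrow> val Back i [] {-1..0} = v_start"
proof (induction i rule: int_ge_induct)
  case base
  then show ?case by (subst val_step_Nil[OF refl]) (simp_all add: input_at_def)
next
  case (step i)
  then have "input_at x (i + 1) \<noteq> LeftEnd" by (simp add: input_at_def)
  then have c: "clamp (input_at x (i + 1)) MoveLeft = MoveLeft"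
    by (cases "input_at x (i + 1)") auto
  show ?case
    using step \<open>input_at x (i + 1) \<noteq> LeftEnd\<close>
    by (subst val_step_Nil[OF refl]) (simp_all add: c)
qed

lemma val_Back_suffix:
  "suffix [] x \<Longrightarrow> val Back (1 + int (length x)) [] {-1..0} = v_start"
  "suffix (b # ys) x \<Longrightarrow> val Back (int (length x) - int (length ys)) [] {-1..0} = v_start"
  by (auto intro!: val_Back dest: suffix_length_le)

lemma val_Start: "3 * v_start =
    val (First Acc_next) 1 [] {-1..0} + val (First Rej_fst) 1 [] {-1..0} + val (First Rej_snd) 1 [] {-1..0}"
  by (subst val_step_Nil[OF refl]) (simp_all add: input_at_def integral_pmf_of_set)

text \<open>\<open>Start\<close> mixes the three passes uniformly, so their gains average to 0. This
  fixed-point equation determines \<open>v_start\<close>.\<close>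

lemma gain_Start: "gain (First Acc_next) x + gain (First Rej_fst) x + gain (First Rej_snd) x = 0"
  using val_Start by (simp add: gain_def)

context
  assumes reject: "\<And>i. val Reject i [] {-1..0} = 0"
begin

text \<open>Rejection has value 0 and hence gain \<open>- v_start\<close>, in contrast to the gain 0
  of a restart.\<close>

lemma gain_First:
  "suffix [] x \<Longrightarrow> gain (First m) [] = - v_start"
  "suffix (b # ys) x \<Longrightarrow>
    gain (First m) (b # ys) = (if b then - v_start else \<theta> ^ fst_cost m * gain (Second m) ys)"
  unfolding gain_def
  by (subst val_step_Nil[OF input_at_suffix]; simp add: expectation_coin integral_pmf_of_set reject
      theta_bounds less_imp_le val_Back_suffix algebra_simps)+

lemma gain_Second:
  "suffix [] x \<Longrightarrow> gain (Second m) [] = - v_start"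
  "suffix (b # ys) x \<Longrightarrow> gain (Second m) (b # ys) = (if b then gain (Header m) ys else - v_start)"
  unfolding gain_def
  by (subst val_step_Nil[OF input_at_suffix]; simp add: expectation_coin integral_pmf_of_set reject
      theta_bounds less_imp_le val_Back_suffix algebra_simps)+

lemma gain_Header:
  "suffix [] x \<Longrightarrow> gain (Header m) [] = - v_start"
  "suffix (b # ys) x \<Longrightarrow> gain (Header m) (b # ys) =
    (if b \<noteq> a then - v_start
     else if m = Acc_next then 2 / 3 * gain (Block m Acc_next) ys + 1 / 3 * gain (Block m Acc_last) ys
     else (gain (Block m Rej_fst) ys + gain (Block m Rej_snd) ys + gain (Block m Rej_last) ys) / 3)"
  unfolding gain_def
  by (subst val_step_Nil[OF input_at_suffix]; simp add: expectation_coin integral_pmf_of_set reject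
      theta_bounds less_imp_le val_Back_suffix field_simps)+

lemma gain_Block:
  "suffix [] x \<Longrightarrow> gain (Block m m') [] =
    (if m' = Acc_last then v_pass - v_start else if m' = Rej_last then - v_start / 64 else 0)"
  "suffix (b # ys) x \<Longrightarrow> gain (Block m m') (b # ys) =
    (if b then if m' \<in> {Acc_last, Rej_last} then 0 else gain (Header m') ys
     else \<theta> ^ (snd_cost m + fst_cost m') * gain (Block m m') ys)"
  unfolding gain_def
  by (subst val_step_Nil[OF input_at_suffix]; simp add: expectation_coin integral_pmf_of_set reject
      theta_bounds less_imp_le val_Back_suffix algebra_simps)+

lemma gain_Block_zeros:
  "suffix (replicate k False @ ys) x \<Longrightarrow> gain (Block m m') (replicate k False @ ys) =
    \<theta> ^ ((snd_cost m + fst_cost m') * k) * gain (Block m m') ys"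
proof (induction k)
  case (Suc k)
  then have "suffix (replicate k False @ ys) x" by (auto dest: suffix_ConsD)
  with Suc show ?case by (simp add: gain_Block power_add)
qed simp

text \<open>\<open>\<theta> ^ m\<close> and \<open>\<theta> ^ (2 * m)\<close> are what block
  \<open>m\<close> pays as right member of the pair with its left neighbour, a pair outside the
  weight; \<open>Rej_fst\<close> pays nothing there. The 1/64 is the final coin of a rejecting
  pass.\<close>

lemma gain_Header_blocks:
  assumes "suffix (a # replicate m False @ blocks a ms) x"
  shows "gain (Header Acc_next) (a # replicate m False @ blocks a ms) =
        \<theta> ^ m * weight_acc (m # ms) * (v_pass - v_start) \<and>
      gain (Header Rej_fst) (a # replicate m False @ blocks a ms) = - weight_rej (m # ms) / 64 * v_start \<and>
      gain (Header Rej_snd) (a # replicate m False @ blocks a ms) =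
        - (\<theta> ^ (2 * m) * weight_rej (m # ms) / 64 * v_start)"
  using assms
proof (induction ms arbitrary: m)
  case Nil
  from Nil have "suffix (replicate m False @ []) x" by (auto dest: suffix_ConsD)
  note gain_Block_zeros[OF this, unfolded append_Nil2]
  with Nil show ?case
    by (simp add: gain_Header gain_Block)
next
  case (Cons m' ms)
  let ?tl = "a # replicate m' False @ blocks a ms"
  let ?ys = "replicate m False @ True # ?tl"
  have ys: "suffix ?ys x" "suffix (True # ?tl) x" "suffix ?tl x"
    using Cons.prems by (auto dest: suffix_ConsD suffix_appendD)
  note [simp] = Cons.IH[OF ys(3)] gain_Block_zeros[OF ys(1)] gain_Block(2)[OF ys(2)]
  note h = gain_Header(2)[OF Cons.prems[unfolded blocks_simps]]
  define t where "t = \<theta> ^ m"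
  have pw: "\<theta> ^ m = t" "\<theta> ^ (k * m) = t ^ k" for k
    unfolding t_def by (simp_all add: mult.commute[of k] power_mult)
  show ?case
    unfolding blocks_simps h by (simp add: pw power_add) (simp add: field_simps eval_nat_numeral)
qed

text \<open>Every pass that survives up to the defective header is rejected there, so none reaches
  \<open>Increment\<close>. The factor \<open>K\<close> is the probability of that rejection, and
  accepting passes get that far with positive probability.\<close>

lemma gain_Header_malformed:
  assumes "suffix ys x" "\<nexists>ms. True # ys = blocks a ms"
  shows "\<exists>K>0. gain (Header Acc_next) ys = - K * v_start"
    and "m \<in> {Rej_fst, Rej_snd} \<Longrightarrow> \<exists>K\<ge>0. gain (Header m) ys = - K * v_start"
proof -
  have "(\<exists>K>0. gain (Header Acc_next) ys = - K * v_start) \<and>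
    (\<forall>m\<in>{Rej_fst, Rej_snd}. \<exists>K\<ge>0. gain (Header m) ys = - K * v_start)"
    using assms
  proof (induction "length ys" arbitrary: ys rule: less_induct)
    case less
    show ?case
    proof (cases "\<exists>zs. ys = a # zs")
      case False
      then have "gain (Header m) ys = - 1 * v_start" for m
        using less.prems by (cases ys) (auto simp: gain_Header)
      then show ?thesis using zero_less_one zero_le_one by blast
    next
      case True
      then obtain zs where ys: "ys = a # zs" ..
      define k where "k = length (takeWhile Not zs)"
      have tw: "takeWhile Not zs = replicate k False"
        unfolding k_def by (rule replicate_length_same[symmetric]) (auto dest: set_takeWhileD)
      then have zs: "zs = replicate k False @ dropWhile Not zs"
        by (metis takeWhile_dropWhile_id)
      show ?thesis
      proof (cases "dropWhile Not zs")
        case Nil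
        \<comment> \<open>Zeros up to the right end would form a proper last block, so the defect
          must lie beyond a further 1.\<close>
        with zs have "zs = replicate k False" by (metis append_Nil2)
        then have "True # ys = blocks a [k]" using ys by simp
        with less.prems show ?thesis by blast
      next
        case (Cons b us)
        then have b: "b" using hd_dropWhile[of Not zs] by simp
        have ys': "ys = a # replicate k False @ True # us" using ys zs Cons b by simp
        have suf: "suffix (replicate k False @ True # us) x" "suffix (True # us) x" "suffix us x"
          using less.prems(1) unfolding ys' by (auto dest: suffix_ConsD suffix_appendD)
        have "\<nexists>ms. True # us = blocks a ms"
        proof
          assume "\<exists>ms. True # us = blocks a ms"
          then obtain ms where "True # us = blocks a ms" ..
          then have "True # ys = blocks a (k # ms)" using ys' by simp
          with less.prems show False by blast
        qed
        then have IH: "\<exists>K>0. gain (Header Acc_next) us = - K * v_start"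
          "\<exists>K\<ge>0. gain (Header Rej_fst) us = - K * v_start"
          "\<exists>K\<ge>0. gain (Header Rej_snd) us = - K * v_start"
          using less.hyps[of us] suf ys' by auto
        then obtain K1 K2 K3 where K: "K1 > 0" "K2 \<ge> 0" "K3 \<ge> 0"
          "gain (Header Acc_next) us = - K1 * v_start"
          "gain (Header Rej_fst) us = - K2 * v_start"
          "gain (Header Rej_snd) us = - K3 * v_start" by blast
        note g = gain_Header(2)[OF less.prems(1)[unfolded ys']] gain_Block_zeros[OF suf(1)] gain_Block(2)[OF suf(2)]
        have "gain (Header Acc_next) ys = - (2 / 3 * \<theta> ^ (k + (k + k)) * K1) * v_start"
          unfolding ys' by (simp add: g K)
        moreover have "gain (Header m) ys = - ((\<theta> ^ ((snd_cost m + 4) * k) * K2 + \<theta> ^ (snd_cost m * k) * K3) / 3) * v_start"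
          if "m \<in> {Rej_fst, Rej_snd}" for m
          using that unfolding ys' by (auto simp: g K field_simps)
        moreover have "0 < 2 / 3 * \<theta> ^ (k + (k + k)) * K1"
          "0 \<le> (\<theta> ^ ((snd_cost m + 4) * k) * K2 + \<theta> ^ (snd_cost m * k) * K3) / 3" for m
          using K theta_bounds by (auto intro!: divide_nonneg_pos add_nonneg_nonneg mult_nonneg_nonneg)
        ultimately show ?thesis by blast
      qed
    qed
  qed
  then show "\<exists>K>0. gain (Header Acc_next) ys = - K * v_start"
    and "m \<in> {Rej_fst, Rej_snd} \<Longrightarrow> \<exists>K\<ge>0. gain (Header m) ys = - K * v_start" by auto
qed

text \<open>Solves \<open>gain_Start\<close> for \<open>v_start\<close>, with the leading 0 as a
  block of length 1. The 32 is 64 from the final coin, halved because \<open>Start\<close> enters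
  the accepting pass with probability 1/3 where \<open>weight_acc\<close> counts 2/3.\<close>

lemma v_start_well_formed:
  assumes "x = False # blocks a ms" "ms \<noteq> []"
  shows "(32 * weight_acc (1 # ms) + weight_rej (1 # ms)) * v_start = 32 * weight_acc (1 # ms) * v_pass"
proof -
  obtain m ms' where ms: "ms = m # ms'" using assms(2) by (cases ms) auto
  let ?tl = "a # replicate m False @ blocks a ms'"
  have x: "x = False # True # ?tl" using assms ms by simp
  then have suf: "suffix (False # True # ?tl) x" "suffix (True # ?tl) x" "suffix ?tl x"
    by (auto intro: suffix_ConsI)
  have "\<theta> ^ 2 * (\<theta> ^ m * weight_acc ms * (v_pass - v_start)) - \<theta> ^ 4 * (weight_rej ms / 64 * v_start)
      - \<theta> ^ (2 * m) * weight_rej ms / 64 * v_start = 0"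
    using gain_Start
    by (simp add: gain_First(2)[OF suf(1), folded x] gain_Second(2)[OF suf(2)] gain_Header_blocks[OF suf(3)] ms)
  moreover have "weight_acc (1 # ms) = 2 / 3 * (\<theta> ^ 2 * \<theta> ^ m) * weight_acc ms"
    "weight_rej (1 # ms) = 1 / 3 * (\<theta> ^ 4 + \<theta> ^ (2 * m)) * weight_rej ms"
    by (simp_all add: ms power_add power2_eq_square)
  ultimately show ?thesis
    by (simp only:) (simp add: field_simps)
qed

text \<open>All three gains in \<open>gain_Start\<close> are nonpositive multiples of
  \<open>v_start\<close>, the accepting one strictly negative, and they sum to 0.\<close>

lemma v_start_malformed:
  assumes "\<nexists>ms. ms \<noteq> [] \<and> x = False # blocks a ms"
  shows "v_start = 0"
proof -
  consider "x = []" | ys where "x = True # ys" | "x = [False]" | ys where "x = False # False # ys"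
    | ys where "x = False # True # ys" by (metis list.exhaust)
  then show ?thesis
  proof cases
    case 5
    then have suf: "suffix (False # True # ys) x" "suffix (True # ys) x" "suffix ys x"
      by (auto intro: suffix_ConsI)
    have "\<nexists>ms. True # ys = blocks a ms"
      using assms 5 by (metis blocks_simps(1) list.distinct(1))
    then obtain K1 K2 K3 where K: "K1 > 0" "K2 \<ge> 0" "K3 \<ge> 0"
      "gain (Header Acc_next) ys = - K1 * v_start"
      "gain (Header Rej_fst) ys = - K2 * v_start"
      "gain (Header Rej_snd) ys = - K3 * v_start"
      using gain_Header_malformed[OF suf(3)] by (meson insertI1 insertI2)
    have "(\<theta> ^ 2 * K1 + \<theta> ^ 4 * K2 + K3) * v_start = 0"
      using gain_Start
      by (simp add: gain_First(2)[OF suf(1), folded 5] gain_Second(2)[OF suf(2)] K algebra_simps)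
    moreover have "\<theta> ^ 2 * K1 + \<theta> ^ 4 * K2 + K3 > 0"
      using K theta_bounds by (intro add_pos_nonneg mult_pos_pos mult_nonneg_nonneg) (auto simp: less_imp_le)
    ultimately show ?thesis by simp
  next
    case 1
    have "gain (First m) x = - v_start" for m
      using gain_First(1)[OF suffix_bot.bot_least, folded 1] .
    then show ?thesis using gain_Start by simp
  next
    case 2
    then have "suffix (True # ys) x" by simp
    then have "gain (First m) x = - v_start" for m
      using gain_First(2)[of True ys, folded 2] by simp
    then show ?thesis using gain_Start by simp
  next
    case 3
    then have suf: "suffix [False] x" "suffix [] x" by auto
    have "(\<theta> ^ 2 + \<theta> ^ 4 + 1) * v_start = 0"
      using gain_Start
      by (simp add: gain_First(2)[OF suf(1), folded 3] gain_Second(1)[OF suf(2)] algebra_simps)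
    moreover have "\<theta> ^ 2 + \<theta> ^ 4 + 1 > 0" using theta_bounds(4)[of 2] theta_bounds(4)[of 4] by linarith
    ultimately show ?thesis by simp
  next
    case 4
    then have suf: "suffix (False # False # ys) x" "suffix (False # ys) x"
      by (auto intro: suffix_ConsI)
    have "(\<theta> ^ 2 + \<theta> ^ 4 + 1) * v_start = 0"
      using gain_Start
      by (simp add: gain_First(2)[OF suf(1), folded 4] gain_Second(2)[OF suf(2)] algebra_simps)
    moreover have "\<theta> ^ 2 + \<theta> ^ 4 + 1 > 0" using theta_bounds(4)[of 2] theta_bounds(4)[of 4] by linarith
    ultimately show ?thesis by simp
  qed
qed

end

end

section \<open>Finding the least nondivisor\<close>

lemma least_nondivisor:
  assumes "n > 0"
  shows "least_nondivisor n > 1" "\<not> least_nondivisor n dvd n"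
    and "0 < i \<Longrightarrow> i < least_nondivisor n \<Longrightarrow> i dvd n"
proof -
  have ex: "\<exists>i>0. \<not> i dvd n"
    using assms dvd_imp_le[of "Suc n" n] by (intro exI[of _ "Suc n"]) auto
  from LeastI_ex[OF ex] have F: "least_nondivisor n > 0" "\<not> least_nondivisor n dvd n"
    unfolding least_nondivisor_def by auto
  then show "\<not> least_nondivisor n dvd n" by simp
  have "least_nondivisor n \<noteq> 1" using F(2) by auto
  with F show "least_nondivisor n > 1" by linarith
  show "i dvd n" if "0 < i" "i < least_nondivisor n"
    using not_less_Least[of i "\<lambda>i. 0 < i \<and> \<not> i dvd n"] that by (auto simp: least_nondivisor_def)
qed

context log_machine_run
begin

lemma val_unfold:
  assumes "q \<noteq> Accept" "q \<noteq> Reject"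
  shows "val q i vs W = (let \<sigma> = input_at x i; (s, vs') = sweep (op_of q \<sigma>) vs in
    measure_pmf.expectation (nxt a p q \<sigma> s)
      (\<lambda>(q', d). val q' (i + offset (clamp \<sigma> d)) vs' (W \<union> {-1..int (length vs)})))"
  using val_step[OF refl _ assms] by (auto simp: Let_def split_beta)

context
  fixes w :: nat
begin

lemma visited_absorb: "W \<subseteq> {-1..int w} \<Longrightarrow> W \<union> {-1..int w} = {-1..int w}"
  by auto

abbreviation pos :: "bool list \<Rightarrow> int" where
  "pos ys \<equiv> int (length x) - int (length ys) + 1"

lemma val_Rewind:
  "0 \<le> i \<Longrightarrow> i \<le> int (length x) + 1 \<Longrightarrow> W \<subseteq> {-1..int w} \<Longrightarrow>
    val Rewind i (cells w ns) W = val (Scan False) 1 (cells w ns) {-1..int w}"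
proof (induction i arbitrary: W rule: int_ge_induct)
  case base
  then show ?case
    by (subst val_unfold) (simp_all add: input_at_def sweep_Nop visited_absorb)
next
  case (step i)
  then have ne: "input_at x (i + 1) \<noteq> LeftEnd" by (simp add: input_at_def)
  then have c: "clamp (input_at x (i + 1)) MoveLeft = MoveLeft"
    by (cases "input_at x (i + 1)") auto
  have "val Rewind (i + 1) (cells w ns) W = val Rewind i (cells w ns) {-1..int w}"
    using step.prems by (subst val_unfold) (simp_all add: ne c sweep_Nop visited_absorb)
  with step show ?case by simp
qed

lemma val_Scan_False:
  assumes "suffix (replicate k False @ ys) x"
  shows "val (Scan e) (pos (replicate k False @ ys)) (cells w ns) {-1..int w} =
    val (Scan e) (pos ys) (cells w ns) {-1..int w}"
  using assms
proof (induction k)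
  case (Suc k)
  then have "suffix (replicate k False @ ys) x" by (auto dest: suffix_ConsD)
  moreover have "val (Scan e) (pos (False # replicate k False @ ys)) (cells w ns) {-1..int w} =
    val (Scan e) (pos (replicate k False @ ys)) (cells w ns) {-1..int w}"
    using input_at_suffix[OF Suc.prems]
    by (subst val_unfold) (simp_all add: sweep_Nop algebra_simps visited_absorb)
  ultimately show ?case using Suc.IH by simp
qed simp

text \<open>\<open>c\<close> is the number of blocks already passed, modulo \<open>i\<close>. Each
  block overwrites the flag by whether its tick wrapped around, so after the last block the flag
  decides divisibility.\<close>

lemma val_Scan_blocks:
  assumes "suffix (blocks a ns) x" "c < i" "i < 64 ^ w"
  shows "val (Scan e) (pos (blocks a ns)) (cells w [i, c, 0, 0]) {-1..int w} =
    val (Scan (if ns = [] then e else i dvd c + length ns)) (int (length x) + 1)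
      (cells w [i, (c + length ns) mod i, 0, 0]) {-1..int w}"
  using assms
proof (induction ns arbitrary: c e)
  case Nil
  then show ?case by simp
next
  case (Cons m ns)
  let ?c = "Suc c mod i"
  let ?ys = "replicate m False @ blocks a ns"
  have suf: "suffix (True # a # ?ys) x" "suffix (a # ?ys) x" "suffix ?ys x" "suffix (blocks a ns) x"
    using Cons.prems by (auto dest: suffix_ConsD suffix_appendD)
  obtain b where b: "sweep (Tick 1) (cells w [i, c, 0, 0]) = ((b, Suc c = i), cells w [i, ?c, 0, 0])"
    using sweep_Tick[of 1 "[i, c, 0, 0]" w] Cons.prems by auto
  have "val (Scan e) (pos (True # a # ?ys)) (cells w [i, c, 0, 0]) {-1..int w} =
      val (Skip (Suc c = i)) (pos (a # ?ys)) (cells w [i, ?c, 0, 0]) {-1..int w}"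
    using input_at_suffix[OF suf(1)] b
    by (subst val_unfold) (simp_all add: visited_absorb)
  also have "\<dots> = val (Scan (Suc c = i)) (pos ?ys) (cells w [i, ?c, 0, 0]) {-1..int w}"
    using input_at_suffix[OF suf(2)]
    by (subst val_unfold) (simp_all add: visited_absorb sweep_Nop algebra_simps)
  also have "\<dots> = val (Scan (Suc c = i)) (pos (blocks a ns)) (cells w [i, ?c, 0, 0]) {-1..int w}"
    by (rule val_Scan_False) (rule suf)
  also have "\<dots> = val (Scan (if ns = [] then Suc c = i else i dvd ?c + length ns)) (int (length x) + 1)
      (cells w [i, (?c + length ns) mod i, 0, 0]) {-1..int w}"
    using Cons.prems suf by (intro Cons.IH) auto
  also have "(?c + length ns) mod i = (c + length (m # ns)) mod i"
    by (simp add: mod_add_left_eq)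
  also have "(if ns = [] then Suc c = i else i dvd ?c + length ns) = (i dvd c + length (m # ns))"
  proof -
    have "i dvd Suc c \<longleftrightarrow> Suc c = i" using Cons.prems by (auto dest: dvd_imp_le)
    moreover have "i dvd ?c + length ns \<longleftrightarrow> i dvd Suc c + length ns"
      by (simp add: dvd_eq_mod_eq_0 mod_add_left_eq)
    ultimately show ?thesis by simp
  qed
  finally show ?case by simp
qed

end

context
  fixes ms :: "nat list"
  assumes x: "x = False # blocks a ms" and ms: "ms \<noteq> []"
begin

abbreviation right_end :: int where "right_end \<equiv> int (length x) + 1"

lemma input_at_right_end: "input_at x right_end = RightEnd"
  by (simp add: input_at_def)

lemma val_Increment:
  assumes "tight w i" "W \<subseteq> {-1..int w}"
  obtains w' where "tight w' (Suc i)"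
    "val Increment right_end (cells w [i, 0, 0, 0]) W =
      (if Suc i dvd length ms then val Increment right_end (cells w' [Suc i, 0, 0, 0]) {-1..int w'}
       else val Check right_end (cells w' [Suc i, length ms mod Suc i, 0, 0]) {-1..int w'})"
proof -
  obtain s w' where s: "sweep Inc (cells w [i, 0, 0, 0]) = (s, cells w' [Suc i, 0, 0, 0])"
    and w': "tight w' (Suc i)" "w' \<ge> w"
    using sweep_Inc[OF assms(1)] by blast
  have i: "Suc i < 64 ^ w'" using w' by (simp add: tight_def)
  have "val Increment right_end (cells w [i, 0, 0, 0]) W =
      val Rewind right_end (cells w' [Suc i, 0, 0, 0]) (W \<union> {-1..int w})"
    using s by (subst val_unfold) (simp_all add: input_at_right_end)
  also have "\<dots> = val (Scan False) 1 (cells w' [Suc i, 0, 0, 0]) {-1..int w'}"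
    using assms(2) w' by (intro val_Rewind) auto
  also have "\<dots> = val (Scan False) (int (length x) - int (length (blocks a ms)) + 1) (cells w' [Suc i, 0, 0, 0]) {-1..int w'}"
    using val_Scan_False[of 1 "blocks a ms" False w' "[Suc i, 0, 0, 0]"] by (simp add: x)
  also have "\<dots> = val (Scan (Suc i dvd length ms)) right_end (cells w' [Suc i, length ms mod Suc i, 0, 0]) {-1..int w'}"
    using val_Scan_blocks[of ms 0 "Suc i" w' False] i ms by (simp add: x suffix_ConsI)
  also have "\<dots> = val (if Suc i dvd length ms then Increment else Check) right_end
      (cells w' [Suc i, length ms mod Suc i, 0, 0]) {-1..int w'}"
    by (subst val_unfold) (simp_all add: input_at_right_end sweep_Nop)
  finally show ?thesis
    using that[OF w'(1)] by (simp add: dvd_eq_mod_eq_0)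
qed

lemma val_Increment_least_nondivisor:
  obtains w where "tight w (least_nondivisor (length ms))"
    "val Increment right_end [] {-1..0} =
      val Check right_end (cells w [least_nondivisor (length ms), length ms mod least_nondivisor (length ms), 0, 0]) {-1..int w}"
proof -
  let ?F = "least_nondivisor (length ms)"
  have "length ms > 0" using ms by simp
  note F = least_nondivisor[OF this]
  have "\<exists>w. tight w ?F \<and> val Increment right_end (cells v [i, 0, 0, 0]) W =
      val Check right_end (cells w [?F, length ms mod ?F, 0, 0]) {-1..int w}"
    if "tight v i" "W \<subseteq> {-1..int v}" "i < ?F" for v i W
    using that
  proof (induction "?F - i" arbitrary: v i W rule: less_induct)
    case less
    obtain w where w: "tight w (Suc i)" "val Increment right_end (cells v [i, 0, 0, 0]) W =
      (if Suc i dvd length ms then val Increment right_end (cells w [Suc i, 0, 0, 0]) {-1..int w}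
       else val Check right_end (cells w [Suc i, length ms mod Suc i, 0, 0]) {-1..int w})"
      using val_Increment[OF less.prems(1,2)] by blast
    show ?case
    proof (cases "Suc i = ?F")
      case True
      with w F(2) show ?thesis by auto
    next
      case False
      with less.prems have "Suc i < ?F" by simp
      with F(3)[of "Suc i"] w less.hyps[of "Suc i" w "{-1..int w}"] show ?thesis by auto
    qed
  qed
  \<comment> \<open>The empty tape is the number 0 in zero digits, so the search starts at
    \<open>i = 0\<close>.\<close>
  from this[of 0 0 "{-1..0}"] F(1) that show ?thesis by (auto simp: tight_def)
qed

end

end

section \<open>The size of the least nondivisor\<close>

text \<open>
  Nair's argument: \<open>a! b! / (a + b + 1)!\<close> is the integral of \<open>t\<^sup>a (1 - t)\<^sup>b\<close> over \<open>[0, 1]\<close>, so it is an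
  integer combination of the numbers \<open>1 / i\<close> for \<open>i \<le> a + b + 1\<close>.
\<close>

lemma multiple_of_beta_Ints:
  assumes "\<And>i. 0 < i \<Longrightarrow> i \<le> a + b + 1 \<Longrightarrow> i dvd n"
  shows "real n * (fact a * fact b / fact (a + b + 1)) \<in> \<int>"
  using assms
proof (induction b arbitrary: a)
  case 0
  then have "Suc a dvd n" by simp
  then obtain k where "n = Suc a * k" ..
  then have "real n * (fact a * fact 0 / fact (a + 0 + 1)) = of_nat k"
    by (simp del: of_nat_Suc mult_Suc)
  then show ?case by (metis Ints_of_nat)
next
  case (Suc b)
  \<comment> \<open>Subtracting the integral for \<open>(Suc a, b)\<close> from that for
    \<open>(a, b)\<close> multiplies the integrand by \<open>1 - t\<close>, which gives the one for
    \<open>(a, Suc b)\<close>.\<close>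
  have "real n * (fact a * fact b / fact (a + b + 1)) \<in> \<int>"
    "real n * (fact (Suc a) * fact b / fact (Suc a + b + 1)) \<in> \<int>"
    using Suc.prems by (intro Suc.IH; simp)+
  then have "real n * (fact a * fact b / fact (a + b + 1)) -
      real n * (fact (Suc a) * fact b / fact (Suc a + b + 1)) \<in> \<int>" by (rule Ints_diff)
  also have "real n * (fact a * fact b / fact (a + b + 1)) -
      real n * (fact (Suc a) * fact b / fact (Suc a + b + 1)) =
      real n * (fact a * fact (Suc b) / fact (a + Suc b + 1))"
  proof -
    have f: "fact (Suc a) = (1 + real a) * fact a" "fact (Suc b) = (real b + 1) * fact b"
      "fact (Suc a + b + 1) = (real a + real b + 2) * fact (a + b + 1)"
      "fact (a + Suc b + 1) = (real a + real b + 2) * fact (a + b + 1)"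
      by (simp_all add: algebra_simps)
    have "N * (A * B / C) - N * ((z - y - 1) * A * B / (z * C)) = N * (A * ((y + 1) * B) / (z * C))"
      if "C > 0" "z > 0" for N A B C y z :: real
      using that by (simp add: field_simps)
    from this[of "fact (a + b + 1)" "real a + real b + 2" "real n" "fact a" "fact b" "real b"]
    show ?thesis unfolding f by simp
  qed
  finally show ?case .
qed

text \<open>For \<open>a = b = m\<close> the multiple of the integral is a positive integer, so
  \<open>n\<close> is at least the reciprocal \<open>(2 * m + 1) * ((2 * m) choose m)\<close> of the
  integral, and the central binomial coefficient bounds this below by \<open>4 ^ m\<close>.\<close>

lemma four_power_le_of_divisors:
  assumes "\<And>i. 0 < i \<Longrightarrow> i \<le> 2 * m + 1 \<Longrightarrow> i dvd n" "n > 0"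
  shows "4 ^ m \<le> n"
proof (cases "m = 0")
  case False
  let ?B = "fact m * fact m / fact (2 * m + 1) :: real"
  have "real n * ?B \<in> \<int>"
    using multiple_of_beta_Ints[of m m n, unfolded mult_2[symmetric]] assms(1) by blast
  moreover have pos: "real n * ?B > 0"
    using assms(2) by (intro mult_pos_pos divide_pos_pos fact_gt_zero) simp_all
  ultimately have "1 \<le> real n * ?B"
    using Ints_nonzero_abs_ge1[of "real n * ?B"] by linarith
  moreover have "(2 * real m + 1) * real ((2 * m) choose m) * ?B = 1"
  proof -
    have "real ((2 * m) choose m) = fact (2 * m) / (fact m * fact m)"
      using binomial_fact[of m "2 * m", where ?'a = real] by (simp only: mult_2 add_diff_cancel_right' le_add1)
    moreover have "fact (2 * m + 1) = (2 * real m + 1) * fact (2 * m)"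
      by simp
    moreover have "c * (F / (M * M)) * (M * M / (c * F)) = 1" if "c > 0" "F > 0" "M > 0" for c F M :: real
      using that by simp
    from this[of "2 * real m + 1" "fact (2 * m)" "fact m"]
    have "(2 * real m + 1) * (fact (2 * m) / (fact m * fact m)) *
        (fact m * fact m / ((2 * real m + 1) * fact (2 * m))) = 1"
      by (simp only: fact_gt_zero)
    ultimately show ?thesis by (simp only:)
  qed
  moreover have "4 ^ m \<le> (2 * real m + 1) * real ((2 * m) choose m)"
  proof -
    have "4 ^ m / (2 * real m) \<le> real ((2 * m) choose m)"
      using False by (intro central_binomial_lower_bound) simp
    then have "4 ^ m \<le> 2 * real m * real ((2 * m) choose m)"
      using False by (simp add: field_simps)
    also have "\<dots> \<le> (2 * real m + 1) * real ((2 * m) choose m)"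
      by (intro mult_right_mono) auto
    finally show ?thesis .
  qed
  ultimately have "(2 * real m + 1) * real ((2 * m) choose m) * ?B \<le> real n * ?B"
    by linarith
  then have "(2 * real m + 1) * real ((2 * m) choose m) \<le> real n"
    by (rule mult_right_le_imp_le) (intro divide_pos_pos mult_pos_pos fact_gt_zero)
  with \<open>4 ^ m \<le> _\<close> have "(4 :: real) ^ m \<le> real n" by linarith
  then show ?thesis by simp
qed (use assms in simp)

section \<open>Encoding a set in a coin\<close>

text \<open>48 and 16 are 3/4 and 1/4 of 64: far from the threshold 1/2 as well as from a wraparound
  at 0 or 1.\<close>

definition digit :: "nat set \<Rightarrow> nat \<Rightarrow> real" where
  "digit J j = (if j \<in> J then 48 else 16)"

text \<open>Index \<open>k\<close> gets digit number \<open>k + 1\<close> after the point. The first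
  digit stays 0, which makes the bias and with it the variance small.\<close>

definition bias :: "nat set \<Rightarrow> real" where
  "bias J = (\<Sum>j. digit J (Suc j) / 64 ^ (j + 2))"

lemma digit_bounds: "16 \<le> digit J j" "digit J j \<le> 48"
  by (simp_all add: digit_def)

lemma digit_nonneg [simp]: "0 \<le> digit J j"
  by (simp add: digit_def)

lemma sums_geometric_64: "(\<lambda>j. 48 / 64 ^ (j + n)) sums (64 * 48 / (63 * 64 ^ n) :: real)"
proof -
  have "(\<lambda>j. 48 / 64 ^ n * (1 / 64) ^ j) sums (48 / 64 ^ n * (1 / (1 - 1 / 64)) :: real)"
    by (intro sums_mult geometric_sums) simp
  then show ?thesis by (simp add: power_add power_divide mult.commute)
qed

lemma summable_bias: "summable (\<lambda>j. digit J (j + m) / 64 ^ (j + n))"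
  by (rule summable_comparison_test'[OF sums_summable[OF sums_geometric_64[of n]]])
    (simp add: digit_bounds divide_right_mono)

lemma bias_tail:
  "0 \<le> (\<Sum>j. digit J (j + m) / 64 ^ (j + n))"
  "(\<Sum>j. digit J (j + m) / 64 ^ (j + n)) \<le> 64 * 48 / (63 * 64 ^ n)"
proof -
  show "0 \<le> (\<Sum>j. digit J (j + m) / 64 ^ (j + n))"
    by (intro suminf_nonneg summable_bias) simp
  show "(\<Sum>j. digit J (j + m) / 64 ^ (j + n)) \<le> 64 * 48 / (63 * 64 ^ n)"
    using sums_le[OF _ summable_sums[OF summable_bias] sums_geometric_64]
    by (simp add: digit_bounds divide_right_mono)
qed

lemma bias_bounds: "0 \<le> bias J" "bias J \<le> 1 / 80"
  using bias_tail[of J 1 2] by (simp_all add: bias_def)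

text \<open>This is the expected number of heads in \<open>64 ^ k * 64 ^ k\<close> tosses. Digits of
  indices below \<open>k\<close> give a multiple of \<open>64 ^ k\<close>, invisible modulo
  \<open>64 ^ k\<close>; digits of larger indices are collected in \<tau>.\<close>

lemma bias_scaled:
  assumes "k > 0"
  obtains A :: nat and \<tau> where "0 \<le> \<tau>" "\<tau> \<le> 1 / 80"
    "64 ^ k * 64 ^ k * bias J = 64 ^ k * (real A + digit J k / 64 + \<tau>)"
proof -
  define d :: "nat \<Rightarrow> nat" where "d j = (if Suc j \<in> J then 48 else 16)" for j
  have d: "digit J (Suc j) = real (d j)" for j by (simp add: digit_def d_def)
  obtain l where k: "k = Suc l" using assms gr0_implies_Suc by blast
  define \<tau> where "\<tau> = 64 ^ k * (\<Sum>j. digit J (j + Suc k) / 64 ^ (j + (k + 2)))"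
  define A where "A = (\<Sum>j<l. d j * 64 ^ (l - Suc j))"
  have "bias J = (\<Sum>j<k. digit J (Suc j) / 64 ^ (j + 2)) + (\<Sum>j. digit J (j + Suc k) / 64 ^ (j + (k + 2)))"
    unfolding bias_def
    using suminf_split_initial_segment[OF summable_bias[of J 1 2], of k] by (simp add: ac_simps)
  then have "64 ^ k * bias J = 64 ^ k * (\<Sum>j<k. digit J (Suc j) / 64 ^ (j + 2)) + \<tau>"
    by (simp add: \<tau>_def algebra_simps)
  also have "64 ^ k * (\<Sum>j<k. digit J (Suc j) / 64 ^ (j + 2)) = real A + digit J k / 64"
  proof -
    have "64 ^ k * (\<Sum>j<k. digit J (Suc j) / 64 ^ (j + 2)) =
        (\<Sum>j<l. 64 ^ k * (digit J (Suc j) / 64 ^ (j + 2))) + digit J k / 64"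
      by (simp add: k algebra_simps sum_distrib_left)
    also have "(\<Sum>j<l. 64 ^ k * (digit J (Suc j) / 64 ^ (j + 2))) = real A"
      unfolding A_def of_nat_sum
    proof (rule sum.cong)
      fix j assume "j \<in> {..<l}"
      then have "k = (l - Suc j) + (j + 2)" by (auto simp: k)
      then have "(64 :: real) ^ k = 64 ^ (l - Suc j) * 64 ^ (j + 2)" by (metis power_add)
      then show "64 ^ k * (digit J (Suc j) / 64 ^ (j + 2)) = real (d j * 64 ^ (l - Suc j))"
        by (simp add: d)
    qed simp
    finally show ?thesis .
  qed
  finally have "64 ^ k * 64 ^ k * bias J = 64 ^ k * (real A + digit J k / 64 + \<tau>)"
    by (simp add: mult.assoc)
  moreover have "0 \<le> \<tau>" unfolding \<tau>_def by (intro mult_nonneg_nonneg bias_tail) simp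
  moreover have "\<tau> \<le> 64 ^ k * (64 * 48 / (63 * 64 ^ (k + 2)))"
    unfolding \<tau>_def by (intro mult_left_mono bias_tail) simp
  then have "\<tau> \<le> 1 / 80" by (simp add: power_add)
  ultimately show ?thesis using that by blast
qed

lemma expectation_binomial_pmf_Suc:
  assumes "p \<in> {0..1}"
  shows "measure_pmf.expectation (binomial_pmf (Suc n) p) f =
    p * measure_pmf.expectation (binomial_pmf n p) (\<lambda>j. f (Suc j)) +
    (1 - p) * (measure_pmf.expectation (binomial_pmf n p) f :: real)"
proof -
  have "measure_pmf.expectation (binomial_pmf n p \<bind> (\<lambda>j. return_pmf (i + j))) f =
      measure_pmf.expectation (binomial_pmf n p) (\<lambda>j. f (i + j))" for i
    by (simp flip: map_pmf_def)
  then show ?thesis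
    unfolding binomial_pmf_Suc[OF assms]
    using assms by (subst pmf_expectation_bind[of UNIV]) (auto simp: UNIV_bool set_bind_pmf intro!: finite_UN_I)
qed

lemma binomial_moments:
  assumes "p \<in> {0..1}"
  shows "measure_pmf.expectation (binomial_pmf n p) real = n * p"
    and "measure_pmf.expectation (binomial_pmf n p) (\<lambda>j. (real j)\<^sup>2) = n * p * (1 - p) + (n * p)\<^sup>2"
proof -
  note [simp] = assms[unfolded atLeastAtMost_iff] expectation_binomial_pmf_Suc[OF assms] binomial_pmf_0[OF assms]
    integrable_binomial_pmf[OF assms]
  show 1: "measure_pmf.expectation (binomial_pmf n p) real = n * p" for n
    by (induction n) (simp_all add: algebra_simps)
  show "measure_pmf.expectation (binomial_pmf n p) (\<lambda>j. (real j)\<^sup>2) = n * p * (1 - p) + (n * p)\<^sup>2"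
  proof (induction n)
    case (Suc n)
    have "(real (Suc j))\<^sup>2 = (real j)\<^sup>2 + 2 * real j + 1" for j
      by (simp add: power2_eq_square algebra_simps)
    then show ?case by (simp add: Suc 1 del: of_nat_Suc) (simp add: power2_eq_square algebra_simps)
  qed simp
qed

text \<open>In units of \<open>Q\<close>, the mean modulo \<open>Q\<close> lies between 60/80 and
  61/80 or between 20/80 and 21/80, hence at least 19/80 away from 0, 1/2 and 1. Smaller deviations
  give the right answer, and with \<open>Q * Q\<close> tosses the standard deviation is a small
  multiple of \<open>Q\<close>.\<close>

lemma binomial_mod_concentration:
  fixes k :: nat
  assumes "k > 0"
  defines "Q \<equiv> 64 ^ k :: nat"
  shows "measure_pmf.prob (binomial_pmf (Q * Q) (bias J)) {j. (2 * (j mod Q) \<ge> Q) \<noteq> (k \<in> J)} \<le> 1 / 4"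
proof -
  obtain A :: nat and \<tau> where \<tau>: "0 \<le> \<tau>" "\<tau> \<le> 1 / 80"
    and eq: "64 ^ k * 64 ^ k * bias J = 64 ^ k * (real A + digit J k / 64 + \<tau>)"
    using bias_scaled[OF assms(1)] by blast
  have p: "bias J \<in> {0..1}" using bias_bounds[of J] by simp
  let ?M = "binomial_pmf (Q * Q) (bias J)"
  let ?\<mu> = "measure_pmf.expectation ?M real"
  define r where "r = digit J k / 64 + \<tau>"
  have \<mu>: "?\<mu> = real Q * (real A + r)"
    using eq by (simp add: binomial_moments[OF p] Q_def r_def)
  have Q: "real Q > 0" by (simp add: Q_def)
  have "measure_pmf.prob ?M {j. (2 * (j mod Q) \<ge> Q) \<noteq> (k \<in> J)} \<le>
      measure_pmf.prob ?M {j. \<bar>real j - ?\<mu>\<bar> \<ge> 19 / 80 * real Q}"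
  proof (intro measure_pmf.finite_measure_mono subsetI)
    fix j assume "j \<in> {j. (2 * (j mod Q) \<ge> Q) \<noteq> (k \<in> J)}"
    then have j: "(2 * (j mod Q) \<ge> Q) \<noteq> (k \<in> J)" by simp
    have "\<bar>real j - ?\<mu>\<bar> \<ge> 19 / 80 * real Q"
    proof (rule ccontr)
      assume "\<not> \<bar>real j - ?\<mu>\<bar> \<ge> 19 / 80 * real Q"
      then have near: "real Q * (real A + r - 19 / 80) < real j" "real j < real Q * (real A + r + 19 / 80)"
        unfolding \<mu> by (simp_all add: algebra_simps abs_if split: if_splits)
      have r: "if k \<in> J then 3 / 4 \<le> r \<and> r \<le> 61 / 80 else 1 / 4 \<le> r \<and> r \<le> 21 / 80"
        using \<tau> by (simp add: r_def digit_def)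
      have "real Q * (real A + 0) \<le> real Q * (real A + r - 19 / 80)"
        "real Q * (real A + r + 19 / 80) \<le> real Q * (real A + 1)"
        using r Q by (intro mult_left_mono; simp split: if_splits)+
      with near have "real Q * (real A + 0) < real j" "real j < real Q * (real A + 1)"
        by linarith+
      then have "real (Q * A) < real j" "real j < real (Q * (A + 1))"
        by (simp_all add: algebra_simps)
      \<comment> \<open>The deviation does not carry \<open>j\<close> across a multiple of
        \<open>Q\<close>.\<close>
      then have "Q * A < j" "j < Q * (A + 1)" by (simp_all only: of_nat_less_iff)
      then have "j div Q = A" using Q by (intro div_nat_eqI) (auto simp: mult.commute)
      then have m: "real j = real Q * real A + real (j mod Q)"
        using mult_div_mod_eq[of Q j] by (metis of_nat_add of_nat_mult)
      show False
      proof (cases "k \<in> J")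
        case True
        then have "real Q * (real A + 1 / 2) \<le> real Q * (real A + r - 19 / 80)"
          using r Q by (intro mult_left_mono) auto
        with near(1) have "real Q * (real A + 1 / 2) < real j" by linarith
        with m have "real Q < 2 * real (j mod Q)" by (simp add: algebra_simps)
        with j True show False by linarith
      next
        case False
        then have "real Q * (real A + r + 19 / 80) \<le> real Q * (real A + 1 / 2)"
          using r Q by (intro mult_left_mono) auto
        with near(2) have "real j < real Q * (real A + 1 / 2)" by linarith
        with m have "2 * real (j mod Q) < real Q" by (simp add: algebra_simps)
        with j False show False by linarith
      qed
    qed
    then show "j \<in> {j. \<bar>real j - ?\<mu>\<bar> \<ge> 19 / 80 * real Q}" by simp
  qed simp
  also have "\<dots> \<le> measure_pmf.variance ?M real / (19 / 80 * real Q)\<^sup>2"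
    using measure_pmf.Chebyshev_inequality[of real ?M "19 / 80 * real Q", OF _ integrable_binomial_pmf[OF p]] Q
    by simp
  also have "measure_pmf.variance ?M real = real (Q * Q) * bias J * (1 - bias J)"
    using p by (subst measure_pmf.variance_eq) (simp_all add: binomial_moments)
  also have "\<dots> / (19 / 80 * real Q)\<^sup>2 \<le> (real (Q * Q) * (1 / 80)) / (19 / 80 * real Q)\<^sup>2"
  proof (intro divide_right_mono)
    have "bias J * (1 - bias J) \<le> 1 / 80 * 1"
      using bias_bounds[of J] by (intro mult_mono) auto
    then show "real (Q * Q) * bias J * (1 - bias J) \<le> real (Q * Q) * (1 / 80)"
      using mult_left_mono[of "bias J * (1 - bias J)" "1 / 80" "real (Q * Q)"] by (simp add: mult.assoc)
  qed simp
  \<comment> \<open>The quotient is 80/361.\<close>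
  also have "\<dots> \<le> 1 / 4"
    using Q by (simp add: power2_eq_square field_simps)
  finally show ?thesis .
qed

section \<open>Tossing the coin\<close>

context log_machine_run
begin

context
  fixes k :: nat
  assumes k: "k > 0"
begin

lemma sweep_counter:
  assumes "j \<in> {1, 2, 3}" "[64 ^ k, c, d, h] ! j < 64 ^ k"
  obtains b where "sweep (Tick j) (cells (Suc k) [64 ^ k, c, d, h]) =
    ((b, Suc ([64 ^ k, c, d, h] ! j) = 64 ^ k),
      cells (Suc k) ([64 ^ k, c, d, h][j := Suc ([64 ^ k, c, d, h] ! j) mod 64 ^ k]))"
  using sweep_Tick[of j "[64 ^ k, c, d, h]" "Suc k"] assms by auto

abbreviation right_val :: "ctl \<Rightarrow> nat \<Rightarrow> nat \<Rightarrow> nat \<Rightarrow> real" where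
  "right_val q c d h \<equiv> val q (right_end) (cells (Suc k) [64 ^ k, c, d, h]) {-1..int (Suc k)}"

lemma val_unfold_right:
  assumes "q \<noteq> Accept" "q \<noteq> Reject"
  shows "right_val q c d h = (let (s, vs) = sweep (op_of q RightEnd) (cells (Suc k) [64 ^ k, c, d, h]) in
    measure_pmf.expectation (nxt a p q RightEnd s)
      (\<lambda>(q', m). val q' (right_end + offset (clamp (RightEnd :: bool input_symbol) m)) vs {-1..int (Suc k)}))"
  using val_unfold[OF assms, of right_end "cells (Suc k) [64 ^ k, c, d, h]" "{-1..int (Suc k)}"]
  by (simp add: input_at_def del: cells.simps)

lemma val_Toss:
  "right_val Toss c d h = p * right_val Head c d h + (1 - p) * right_val Inner c d h"
  using p01 by (subst val_unfold_right) (simp_all add: sweep_Nop expectation_coin del: cells.simps)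

lemma val_Head:
  assumes "h < 64 ^ k"
  shows "right_val Head c d h = right_val Inner c d (Suc h mod 64 ^ k)"
proof -
  obtain b where "sweep (Tick 3) (cells (Suc k) [64 ^ k, c, d, h]) =
      ((b, Suc h = 64 ^ k), cells (Suc k) [64 ^ k, c, d, Suc h mod 64 ^ k])"
    using sweep_counter[of 3 c d h] assms by (auto simp del: cells.simps)
  then show ?thesis
    by (subst val_unfold_right) (simp_all del: cells.simps)
qed

lemma val_Inner:
  assumes "c < 64 ^ k"
  shows "right_val Inner c d h = right_val (if Suc c = 64 ^ k then Outer else Toss) (Suc c mod 64 ^ k) d h"
proof -
  obtain b where "sweep (Tick 1) (cells (Suc k) [64 ^ k, c, d, h]) =
      ((b, Suc c = 64 ^ k), cells (Suc k) [64 ^ k, Suc c mod 64 ^ k, d, h])"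
    using sweep_counter[of 1 c d h] assms by (auto simp del: cells.simps)
  then show ?thesis
    by (subst val_unfold_right) (simp_all del: cells.simps)
qed

lemma val_Outer:
  assumes "d < 64 ^ k"
  shows "right_val Outer c d h = right_val (if Suc d = 64 ^ k then Decide else Toss) c (Suc d mod 64 ^ k) h"
proof -
  obtain b where "sweep (Tick 2) (cells (Suc k) [64 ^ k, c, d, h]) =
      ((b, Suc d = 64 ^ k), cells (Suc k) [64 ^ k, c, Suc d mod 64 ^ k, h])"
    using sweep_counter[of 2 c d h] assms by (auto simp del: cells.simps)
  then show ?thesis
    by (subst val_unfold_right) (simp_all del: cells.simps)
qed

lemma val_Decide:
  assumes "h < 64 ^ k"
  shows "right_val Decide 0 0 h = right_val (if 2 * h \<ge> 64 ^ k then Accept else Reject) 0 0 h"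
proof -
  obtain e where "sweep Read (cells (Suc k) [64 ^ k, 0, 0, h]) =
      ((2 * h \<ge> 64 ^ k, e), cells (Suc k) [64 ^ k, 0, 0, h])"
    using sweep_Read[OF assms k] by auto
  then show ?thesis
    by (subst val_unfold_right) (simp_all del: cells.simps)
qed

text \<open>Numbers 1 and 2 form a two-digit counter in base \<open>64 ^ k\<close> of the tosses
  made, and \<open>n\<close> tosses remain. The last toss wraps both digits to 0 on the way to
  \<open>Decide\<close>.\<close>

lemma val_Toss_binomial:
  assumes "c < 64 ^ k" "d < 64 ^ k" "n + d * 64 ^ k + c = 64 ^ k * 64 ^ k"
  shows "right_val Toss c d (h mod 64 ^ k) =
    measure_pmf.expectation (binomial_pmf n p) (\<lambda>j. right_val Decide 0 0 ((h + j) mod 64 ^ k))"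
  using assms
proof (induction n arbitrary: c d h)
  case 0
  \<comment> \<open>With both digits below the base, some toss must remain, so \<open>n = 0\<close>
    is contradictory.\<close>
  have "d * 64 ^ k + c < Suc d * 64 ^ k" using 0 by simp
  also have "\<dots> \<le> 64 ^ k * 64 ^ k" using 0 by (intro mult_right_mono) auto
  finally show ?case using 0 by simp
next
  case (Suc n)
  define Q :: nat where "Q = 64 ^ k"
  define E where "E h = measure_pmf.expectation (binomial_pmf n p) (\<lambda>j. right_val Decide 0 0 ((h + j) mod Q))" for h
  have Q: "Q > 0" by (simp add: Q_def)
  have inner: "right_val Inner c d (h mod Q) = E h" for h
  proof -
    \<comment> \<open>Neither digit wraps, only the inner one does, or this was the last
      toss.\<close>
    consider "Suc c < Q" | "Suc c = Q" "Suc d < Q" | "Suc c = Q" "Suc d = Q"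
      using Suc.prems unfolding Q_def[symmetric] by linarith
    then show ?thesis
    proof cases
      case 1
      then show ?thesis
        using Suc.IH[of "Suc c" d h] Suc.prems val_Inner[of c d "h mod Q"]
        by (simp add: Q_def E_def del: cells.simps)
    next
      case 2
      have c: "Suc c mod Q = 0" using 2 by simp
      have "n + Suc d * Q + 0 = Q * Q" using Suc.prems 2 by (simp add: Q_def)
      then show ?thesis
        using 2 Suc.IH[of 0 "Suc d" h] Suc.prems val_Inner[of c d "h mod Q"] val_Outer[of d 0 "h mod Q"]
        by (simp add: c[unfolded Q_def] Q_def E_def del: cells.simps)
    next
      case 3
      have "n + Suc d * Q = Q * Q" using Suc.prems 3(1) by (simp add: Q_def)
      then have "n = 0" unfolding 3 by simp
      have c: "Suc c mod Q = 0" "Suc d mod Q = 0" using 3 by simp_all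
      then show ?thesis
        using 3 \<open>n = 0\<close> Suc.prems val_Inner[of c d "h mod Q"] val_Outer[of d 0 "h mod Q"] p01
        by (simp add: c[unfolded Q_def] Q_def E_def binomial_pmf_0 del: cells.simps)
    qed
  qed
  have "right_val Toss c d (h mod Q) = p * right_val Inner c d (Suc h mod Q) + (1 - p) * right_val Inner c d (h mod Q)"
    using val_Head[of "h mod Q" c d] val_Toss[of c d "h mod Q"] Q by (simp add: Q_def mod_Suc_eq del: cells.simps)
  also have "\<dots> = p * E (Suc h) + (1 - p) * E h"
    by (simp only: inner)
  also have "\<dots> = measure_pmf.expectation (binomial_pmf (Suc n) p) (\<lambda>j. right_val Decide 0 0 ((h + j) mod Q))"
    using p01 by (simp add: expectation_binomial_pmf_Suc E_def)
  finally show ?case by (simp add: Q_def)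
qed

end

end

section \<open>Correctness and space\<close>

context log_machine_run
begin

lemma val_halted:
  assumes "q \<in> {Accept, Reject}"
  shows "val q i vs W = indicator T
    \<lparr>state = log_machine.code q, input_pos = i, work_pos = 0, work_tape = log_machine.tape vs, visited = W\<rparr>"
  using assms log_machine.value_at_acc[OF T, of i vs W] log_machine.value_at_rej[OF T, of i vs W]
  by (auto simp: val_def log_machine.config_at_def log_machine.code_def)

lemma val_Check:
  assumes "tight w i" "i > 0"
  shows "val Check right_end (cells w [i, c, 0, 0]) {-1..int w} =
    val (if \<exists>k. i = 64 ^ k then Toss else Reject) right_end (cells w [i, 0, 0, 0]) {-1..int w}"
  by (subst val_unfold) (simp_all add: input_at_right_end sweep_Test[OF assms])

lemma v_pass_eq:
  assumes "x = False # blocks a ms" "ms \<noteq> []"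
  obtains w where "tight w (least_nondivisor (length ms))"
    "v_pass = val Check right_end (cells w [least_nondivisor (length ms),
       length ms mod least_nondivisor (length ms), 0, 0]) {-1..int w}"
  by (rule val_Increment_least_nondivisor[OF assms])

lemma v_pass_not_power:
  assumes "x = False # blocks a ms" "ms \<noteq> []" "\<nexists>k. least_nondivisor (length ms) = 64 ^ k"
  obtains w where "tight w (least_nondivisor (length ms))"
    "v_pass = val Reject right_end (cells w [least_nondivisor (length ms), 0, 0, 0]) {-1..int w}"
proof (rule v_pass_eq[OF assms(1,2)])
  fix w assume w: "tight w (least_nondivisor (length ms))"
    "v_pass = val Check right_end (cells w [least_nondivisor (length ms),
       length ms mod least_nondivisor (length ms), 0, 0]) {-1..int w}"
  have "least_nondivisor (length ms) > 0"
    using least_nondivisor(1)[of "length ms"] assms(2) by simp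
  from w(2)[unfolded val_Check[OF w(1) this] if_not_P[OF assms(3)]] show ?thesis
    by (rule that[OF w(1)])
qed

lemma v_pass_power:
  assumes "x = False # blocks a ms" "ms \<noteq> []" "least_nondivisor (length ms) = 64 ^ k"
  shows "k > 0" "tight (Suc k) (64 ^ k)"
    "v_pass = measure_pmf.expectation (binomial_pmf (64 ^ k * 64 ^ k) p)
      (\<lambda>j. right_val k (if 2 * (j mod 64 ^ k) \<ge> 64 ^ k then Accept else Reject) 0 0 (j mod 64 ^ k))"
proof -
  have F: "least_nondivisor (length ms) > 1"
    using least_nondivisor(1)[of "length ms"] assms(2) by simp
  then show k: "k > 0" using assms(3) by (cases k) auto
  obtain w where w: "tight w (64 ^ k)"
    "v_pass = val Check right_end (cells w [64 ^ k, length ms mod 64 ^ k, 0, 0]) {-1..int w}"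
    using v_pass_eq[OF assms(1,2)] unfolding assms(3) by blast
  then have [simp]: "w = Suc k" by (intro tight_pow)
  show "tight (Suc k) (64 ^ k)" using w by simp
  have "\<exists>j. (64 :: nat) ^ k = 64 ^ j" by blast
  with w(2) val_Check[OF w(1)] have "v_pass = right_val k Toss 0 0 0"
    by (simp only: \<open>w = Suc k\<close> if_True zero_less_power zero_less_numeral simp_thms)
  also have "\<dots> = measure_pmf.expectation (binomial_pmf (64 ^ k * 64 ^ k) p) (\<lambda>j. right_val k Decide 0 0 (j mod 64 ^ k))"
    using val_Toss_binomial[OF k, of 0 0 "64 ^ k * 64 ^ k" 0] by (simp del: cells.simps)
  finally show "v_pass = measure_pmf.expectation (binomial_pmf (64 ^ k * 64 ^ k) p)
      (\<lambda>j. right_val k (if 2 * (j mod 64 ^ k) \<ge> 64 ^ k then Accept else Reject) 0 0 (j mod 64 ^ k))"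
    by (simp only: val_Decide[OF k] mod_less_divisor zero_less_power zero_less_numeral)
qed

end

section \<open>Words of the right format\<close>

lemma doubling_iff: "doubling (m # ms) \<longleftrightarrow> ms = map (\<lambda>i. m * 2 ^ Suc i) [0..<length ms]"
proof (induction ms arbitrary: m)
  case (Cons m' ms)
  have *: "map (\<lambda>i. m * 2 ^ Suc i) [0..<length (m' # ms)] = 2 * m # map (\<lambda>i. 2 * m * 2 ^ Suc i) [0..<length ms]"
    by (simp del: upt_Suc add: map_upt_Suc mult_ac)
  show ?case
    unfolding doubling.simps Cons.IH * list.inject by (rule conj_cong[OF refl]) (simp only:)
qed simp

lemma log_word_replicate: "log_word (replicate n a) = False # blocks a (map (\<lambda>i. 2 ^ Suc i) [0..<n])"
proof -
  have "map (\<lambda>i. [True, replicate n a ! (i - 1)] @ replicate (2 ^ i) False) [1..<length (replicate n a) + 1] =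
      map (\<lambda>i. [True, replicate n a ! i] @ replicate (2 ^ Suc i) False) [0..<n]"
  proof -
    have "[1..<n + 1] = map Suc [0..<n]" by (simp add: map_Suc_upt del: upt_Suc)
    then show ?thesis by (simp del: upt_Suc)
  qed
  also have "\<dots> = map (\<lambda>i. True # a # replicate (2 ^ Suc i) False) [0..<n]"
    by (intro map_cong) auto
  finally show ?thesis
    by (simp add: log_word_def blocks_def o_def del: upt_Suc power_Suc)
qed

lemma well_formed_iff_log_word:
  "(\<exists>ms. ms \<noteq> [] \<and> x = False # blocks a ms \<and> doubling (1 # ms) \<and> n = length ms) \<longleftrightarrow>
   n > 0 \<and> x = log_word (replicate n a)"
proof
  assume "\<exists>ms. ms \<noteq> [] \<and> x = False # blocks a ms \<and> doubling (1 # ms) \<and> n = length ms"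
  then obtain ms where "ms \<noteq> []" "x = False # blocks a ms" "doubling (1 # ms)" "n = length ms" by blast
  moreover from this have "ms = map (\<lambda>i. 2 ^ Suc i) [0..<n]"
    using doubling_iff[of 1 ms] by (simp only: mult_1)
  ultimately show "n > 0 \<and> x = log_word (replicate n a)"
    unfolding log_word_replicate by (metis length_greater_0_conv)
next
  assume "n > 0 \<and> x = log_word (replicate n a)"
  then show "\<exists>ms. ms \<noteq> [] \<and> x = False # blocks a ms \<and> doubling (1 # ms) \<and> n = length ms"
    by (intro exI[of _ "map (\<lambda>i. 2 ^ Suc i) [0..<n]"]) (auto simp: doubling_iff log_word_replicate)
qed

text \<open>The last block alone has \<open>2 ^ n\<close> zeros.\<close>

lemma length_log_word:
  assumes "n > 0"
  shows "2 ^ n \<le> length (log_word (replicate n a))"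
proof -
  obtain l where n: "n = Suc l" using assms gr0_implies_Suc by blast
  show ?thesis
    unfolding log_word_replicate n by (simp add: blocks_def length_concat)
qed

definition index_set :: "nat set \<Rightarrow> nat set" where
  "index_set I = {k. nth_word k \<in> nth_word ` I}"

lemma LOG_AM75'_restrict_iff:
  "x \<in> LOG (AM75'_restrict a I) \<longleftrightarrow>
    (\<exists>n k. n > 0 \<and> x = log_word (replicate n a) \<and> least_nondivisor n = 64 ^ k \<and> k \<in> index_set I)"
proof -
  have "replicate n a \<in> AM75' a \<longleftrightarrow> n > 0 \<and> (\<exists>k. least_nondivisor n = 64 ^ k)" for n
    by (auto simp: AM75'_def)
  then have "AM75'_restrict a I =
      {replicate n a | n. n > 0 \<and> (\<exists>k. least_nondivisor n = 64 ^ k \<and> k \<in> index_set I)}"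
    unfolding AM75'_restrict_def index_set_def by blast
  then show ?thesis by (auto simp: LOG_def)
qed

section \<open>Triply logarithmic space\<close>

definition space_bound :: "nat \<Rightarrow> nat" where
  "space_bound n = 5 + nat \<lceil>log 2 (log 2 (log 2 (real n)))\<rceil>"

text \<open>The width \<open>w\<close> is logarithmic in the least nondivisor, which is logarithmic
  in \<open>n\<close>, which is logarithmic in \<open>N\<close>. The 2 counts the two blanks, and
  the constant 5 in \<open>space_bound\<close> covers \<open>w \<le> 3\<close>.\<close>

lemma tight_le_space_bound:
  assumes "tight w (least_nondivisor n)" "n > 0" "2 ^ n \<le> N"
  shows "w + 2 \<le> space_bound N"
proof (cases "w \<le> 3")
  case False
  \<comment> \<open>The largest \<open>m\<close> for which \<open>2 * m + 1\<close> is below the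
    least nondivisor.\<close>
  define m where "m = (least_nondivisor n - 2) div 2"
  have F: "64 ^ (w - 1) \<le> least_nondivisor n" using assms(1) False by (auto simp: tight_def)
  have "4 ^ m \<le> n"
    using least_nondivisor[OF assms(2)] assms(2)
    by (intro four_power_le_of_divisors least_nondivisor(3)) (auto simp: m_def)
  \<comment> \<open>The 3 absorbs the rounding in \<open>m\<close>: \<open>2 * m\<close> falls short
    of the least nondivisor by at most 3.\<close>
  have "2 ^ (w - 1) + 3 \<le> (64 :: nat) ^ (w - 1)"
  proof -
    obtain v where v: "w - 1 = Suc v" using False by (cases "w - 1") auto
    have "(2 :: nat) ^ v \<le> 64 ^ v" "(1 :: nat) \<le> 64 ^ v" by (simp_all add: power_mono)
    then show ?thesis unfolding v power_Suc by linarith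
  qed
  then have "2 ^ (w - 1) \<le> 2 * m" using F unfolding m_def by linarith
  then have "(2 :: nat) ^ (2 ^ (w - 1)) \<le> 2 ^ (2 * m)" by (intro power_increasing) auto
  also have "\<dots> = 4 ^ m" by (simp add: power_mult)
  also have "\<dots> \<le> n" by fact
  finally have "2 ^ 2 ^ (w - 1) \<le> n" .
  then have "(2 :: nat) ^ 2 ^ 2 ^ (w - 1) \<le> 2 ^ n" by (intro power_increasing) auto
  also have "\<dots> \<le> N" by fact
  finally have "real (2 ^ 2 ^ 2 ^ (w - 1)) \<le> real N" by (simp only: of_nat_le_iff)
  then have "2 ^ 2 ^ 2 ^ (w - 1) \<le> real N" by (simp only: of_nat_power of_nat_numeral)
  then have "real (2 ^ 2 ^ (w - 1)) \<le> log 2 (real N)" by (rule le_log_of_power) simp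
  then have "2 ^ 2 ^ (w - 1) \<le> log 2 (real N)" by (simp only: of_nat_power of_nat_numeral)
  then have "real (2 ^ (w - 1)) \<le> log 2 (log 2 (real N))" by (rule le_log_of_power) simp
  then have "2 ^ (w - 1) \<le> log 2 (log 2 (real N))" by (simp only: of_nat_power of_nat_numeral)
  then have "real (w - 1) \<le> log 2 (log 2 (log 2 (real N)))" by (rule le_log_of_power) simp
  then have "w - 1 \<le> nat \<lceil>log 2 (log 2 (log 2 (real N)))\<rceil>" by linarith
  then show ?thesis by (simp add: space_bound_def)
qed (simp add: space_bound_def)

lemma space_bound_bigo: "(\<lambda>n. real (space_bound n)) \<in> O(\<lambda>n. log 2 (log 2 (log 2 (real n))))"
proof (rule bigoI[where c = 7])
  show "\<forall>\<^sub>F n in sequentially. norm (real (space_bound n)) \<le> 7 * norm (log 2 (log 2 (log 2 (real n))))"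
    \<comment> \<open>At 16 the triple logarithm \<open>L\<close> reaches 1, and then
      \<open>5 + \<lceil>L\<rceil> \<le> 6 + L \<le> 7 * L\<close>.\<close>
    using eventually_ge_at_top[of 16]
  proof eventually_elim
    case (elim n)
    have 1: "4 \<le> log 2 (real n)" using elim by (simp add: le_log_iff)
    then have 2: "2 \<le> log 2 (log 2 (real n))" by (simp add: le_log_iff)
    then have "1 \<le> log 2 (log 2 (log 2 (real n)))" by (simp add: le_log_iff)
    then show ?case unfolding space_bound_def by simp linarith
  qed
qed

section \<open>Error and space of the machine\<close>

context
  fixes I :: "nat set" and a :: bool
begin

abbreviation (input) J where "J \<equiv> index_set I"

abbreviation (input) M where "M \<equiv> log_machine a (bias J)"

lemma run_accept: "log_machine_run a (bias J) x {c. state c = accepting M}"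
  using bias_bounds[of J] by unfold_locales (auto intro: absorbing_accept)

lemma run_excess: "log_machine_run a (bias J) x {c. card (visited c) > b}"
  using bias_bounds[of J] by unfold_locales (auto intro: absorbing_excess)

text \<open>Equal weights make the odds of passing against rejecting 32 : 1; a violated doubling
  makes them at most 32 : 1024; a malformed word never passes. Stated for any \<open>T\<close> with
  value 0 at rejection, to serve both acceptance and space.\<close>

lemma v_start_bounds:
  assumes "log_machine_run a p x T" "\<And>i. log_machine_run.val a p x T Reject i [] {-1..0} = 0"
  defines "start \<equiv> log_machine_run.val a p x T Start 0 [] {-1..0}"
    and "pass \<equiv> log_machine_run.val a p x T Increment (int (length x) + 1) [] {-1..0}"
  shows "x = False # blocks a ms \<Longrightarrow> ms \<noteq> [] \<Longrightarrow> doubling (1 # ms) \<Longrightarrow> start = 32 / 33 * pass"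
    and "\<nexists>ms. ms \<noteq> [] \<and> x = False # blocks a ms \<and> doubling (1 # ms) \<Longrightarrow> start \<le> 1 / 33"
proof -
  interpret log_machine_run a p x T by fact
  have b: "0 \<le> start" "start \<le> 1" "0 \<le> pass" "pass \<le> 1"
    unfolding start_def pass_def by (rule val_bounds)+
  note eq = v_start_well_formed[OF assms(2), folded start_def pass_def]
  show "start = 32 / 33 * pass" if "x = False # blocks a ms" "ms \<noteq> []" "doubling (1 # ms)"
  proof -
    have "weight_acc (1 # ms) * (33 * start) = weight_acc (1 # ms) * (32 * pass)"
      using eq[OF that(1,2)] weight_doubling[OF that(3)] by (simp add: algebra_simps)
    then show ?thesis using weight_pos(1)[of "1 # ms"] by simp
  qed
  show "start \<le> 1 / 33" if no: "\<nexists>ms. ms \<noteq> [] \<and> x = False # blocks a ms \<and> doubling (1 # ms)"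
  proof (cases "\<exists>ms. ms \<noteq> [] \<and> x = False # blocks a ms")
    case True
    then obtain ms where ms: "ms \<noteq> []" "x = False # blocks a ms" by blast
    with no have "\<not> doubling (1 # ms)" by blast
    then have r: "2 ^ 10 * weight_acc (1 # ms) \<le> weight_rej (1 # ms)"
      by (rule weight_not_doubling)
    have "weight_acc (1 # ms) * (1056 * start) \<le> (32 * weight_acc (1 # ms) + weight_rej (1 # ms)) * start"
      using mult_right_mono[OF r b(1)] by (simp add: algebra_simps)
    also have "\<dots> = weight_acc (1 # ms) * (32 * pass)"
      using eq[OF ms(2,1)] by simp
    finally have "1056 * start \<le> 32 * pass"
      using weight_pos(1)[of "1 # ms"] by simp
    with b show ?thesis by linarith
  next
    case False
    then show ?thesis
      using v_start_malformed[OF assms(2)] by (simp add: start_def)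
  qed
qed

text \<open>Members are accepted with probability at least
  \<open>32 / 33 * (3 / 4) = 8 / 11\<close>. Nonmembers of the right format reach at most
  \<open>32 / 33 * (1 / 4) = 8 / 33\<close>, other words at most 1/33.\<close>

lemma accept_prob_bounds:
  shows "x \<in> LOG (AM75'_restrict a I) \<Longrightarrow> accept_prob M x \<ge> 7 / 10"
    and "x \<notin> LOG (AM75'_restrict a I) \<Longrightarrow> accept_prob M x \<le> 3 / 10"
proof -
  let ?T = "{c. state c = accepting M}"
  interpret log_machine_run a "bias J" x ?T by (rule run_accept)
  have acc: "val Accept i vs W = 1" for i vs W
    by (subst val_halted) (simp_all add: log_machine.machine_def)
  have rej: "val Reject i vs W = 0" for i vs W
    by (subst val_halted) (simp_all add: log_machine.machine_def log_machine.code_def)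
  have start: "accept_prob M x = v_start"
    unfolding accept_prob_eq_hit hit_initial ..
  have pass: "v_pass = measure_pmf.prob (binomial_pmf (64 ^ k * 64 ^ k) (bias J)) {j. 2 * (j mod 64 ^ k) \<ge> 64 ^ k}"
    if "x = False # blocks a ms" "ms \<noteq> []" "least_nondivisor (length ms) = 64 ^ k" for ms k
  proof -
    have "v_pass = measure_pmf.expectation (binomial_pmf (64 ^ k * 64 ^ k) (bias J))
        (indicator {j. 2 * (j mod 64 ^ k) \<ge> 64 ^ k})"
      unfolding v_pass_power(3)[OF that] by (intro Bochner_Integration.integral_cong) (auto simp: acc rej)
    then show "v_pass = measure_pmf.prob (binomial_pmf (64 ^ k * 64 ^ k) (bias J)) {j. 2 * (j mod 64 ^ k) \<ge> 64 ^ k}"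
      by simp
  qed
  note start_pass = v_start_bounds[OF run_accept rej]
  show "accept_prob M x \<ge> 7 / 10" if x_in: "x \<in> LOG (AM75'_restrict a I)"
  proof -
    obtain n k where n: "n > 0" "x = log_word (replicate n a)" "least_nondivisor n = 64 ^ k" "k \<in> J"
      using x_in by (auto simp: LOG_AM75'_restrict_iff)
    then obtain ms where ms: "ms \<noteq> []" "x = False # blocks a ms" "doubling (1 # ms)" "n = length ms"
      using well_formed_iff_log_word by blast
    have F: "least_nondivisor (length ms) = 64 ^ k" using n ms by simp
    let ?P = "binomial_pmf (64 ^ k * 64 ^ k) (bias J)"
    have "measure_pmf.prob ?P {j. 2 * (j mod 64 ^ k) \<ge> 64 ^ k} =
        1 - measure_pmf.prob ?P {j. (2 * (j mod 64 ^ k) \<ge> 64 ^ k) \<noteq> (k \<in> J)}"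
      using n(4) by (subst measure_pmf.prob_compl[symmetric]) (auto intro!: arg_cong2[where f = measure])
    then have "v_pass \<ge> 3 / 4"
      using pass[OF ms(2,1) F] binomial_mod_concentration[of k J] v_pass_power(1)[OF ms(2,1) F] by simp
    then show ?thesis
      using start_pass(1)[OF ms(2,1,3)] start by simp
  qed
  show "accept_prob M x \<le> 3 / 10" if not_in: "x \<notin> LOG (AM75'_restrict a I)"
  proof (cases "\<exists>ms. ms \<noteq> [] \<and> x = False # blocks a ms \<and> doubling (1 # ms)")
    case False
    then show ?thesis using start_pass(2) start by simp
  next
    case True
    then obtain ms where ms: "ms \<noteq> []" "x = False # blocks a ms" "doubling (1 # ms)" by blast
    then have x: "length ms > 0" "x = log_word (replicate (length ms) a)"
      using well_formed_iff_log_word[of x a "length ms"] by auto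
    have "v_pass \<le> 1 / 4"
    proof (cases "\<exists>k. least_nondivisor (length ms) = 64 ^ k")
      case True
      then obtain k where F: "least_nondivisor (length ms) = 64 ^ k" ..
      with not_in x have "k \<notin> J" by (auto simp: LOG_AM75'_restrict_iff)
      then show ?thesis
        using pass[OF ms(2,1) F] binomial_mod_concentration[of k J] v_pass_power(1)[OF ms(2,1) F] by simp
    next
      case False
      show ?thesis
        by (rule v_pass_not_power[OF ms(2,1) False]) (simp add: rej)
    qed
    then show ?thesis
      using start_pass(1)[OF ms(2,1,3)] start by simp
  qed
qed

text \<open>On words of the right format, members or not, the bound is almost surely respected,
  since the width is that of the least nondivisor. On other words the tape grows only after the
  format check errs, which has probability at most 1/33.\<close>

lemma excess_prob_bounds:
  shows "x \<in> LOG (AM75'_restrict a I) \<Longrightarrow> excess_prob M x (space_bound (length x)) = 0"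
    and "excess_prob M x (space_bound (length x)) \<le> 3 / 10"
proof -
  let ?b = "space_bound (length x)"
  interpret log_machine_run a "bias J" x "{c. card (visited c) > ?b}" by (rule run_excess)
  have halted: "val q i vs {-1..int w} = 0" if "w + 2 \<le> ?b" "q \<in> {Accept, Reject}" for q i vs w
    using that by (simp add: val_halted)
  have rej: "val Reject i [] {-1..0} = 0" for i
    using halted[of 0 Reject i "[]"] by (simp add: space_bound_def)
  have start: "excess_prob M x ?b = v_start"
    unfolding excess_prob_eq_hit hit_initial ..
  note start_pass = v_start_bounds[OF run_excess rej]
  have 0: "v_start = 0" if ms: "ms \<noteq> []" "x = False # blocks a ms" "doubling (1 # ms)" for ms
  proof -
    have x: "length ms > 0" "x = log_word (replicate (length ms) a)"
      using ms well_formed_iff_log_word[of x a "length ms"] by auto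
    then have w: "w + 2 \<le> ?b" if "tight w (least_nondivisor (length ms))" for w
      using tight_le_space_bound[OF that x(1)] length_log_word[OF x(1), of a] by simp
    have "v_pass = 0"
    proof (cases "\<exists>k. least_nondivisor (length ms) = 64 ^ k")
      case True
      then obtain k where F: "least_nondivisor (length ms) = 64 ^ k" ..
      have "Suc k + 2 \<le> ?b" using w[of "Suc k"] v_pass_power(2)[OF ms(2,1) F] F by simp
      then show ?thesis
        unfolding v_pass_power(3)[OF ms(2,1) F] by (simp add: halted del: cells.simps of_nat_Suc)
    next
      case False
      obtain v where v: "tight v (least_nondivisor (length ms))"
        "v_pass = val Reject right_end (cells v [least_nondivisor (length ms), 0, 0, 0]) {-1..int v}"
        using v_pass_not_power[OF ms(2,1) False] by blast
      show ?thesis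
        unfolding v(2) by (rule halted) (use w[OF v(1)] in simp_all)
    qed
    then show ?thesis using start_pass(1)[OF ms(2,1,3)] by simp
  qed
  show "excess_prob M x ?b = 0" if x_in: "x \<in> LOG (AM75'_restrict a I)"
  proof -
    obtain n where "n > 0" "x = log_word (replicate n a)"
      using x_in by (auto simp: LOG_AM75'_restrict_iff)
    then obtain ms where "ms \<noteq> []" "x = False # blocks a ms" "doubling (1 # ms)"
      using well_formed_iff_log_word by blast
    then show ?thesis using 0 start by simp
  qed
  show "excess_prob M x ?b \<le> 3 / 10"
    using start 0 start_pass(2) by (cases "\<exists>ms. ms \<noteq> [] \<and> x = False # blocks a ms \<and> doubling (1 # ms)") auto
qed

end

theorem theorem2:
  fixes I :: "nat set" and a :: bool
  assumes "I \<subseteq> {0<..}"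
  shows "bounded_error_recognizable_in_space (LOG (AM75'_restrict a I))
           (\<lambda>n. log 2 (log 2 (log 2 (real n))))"
proof -
  let ?M = "log_machine a (bias (index_set I))"
  have "recognizes_with_error ?M (LOG (AM75'_restrict a I)) (3 / 10)"
    using accept_prob_bounds by (simp add: recognizes_with_error_def)
  moreover have "space_bounded ?M (LOG (AM75'_restrict a I)) (3 / 10) space_bound"
    using excess_prob_bounds by (simp add: space_bounded_def)
  ultimately show ?thesis
    unfolding bounded_error_recognizable_in_space_def
    using log_machine.well_formed_machine space_bound_bigo
    by (intro exI[of _ ?M] exI[of _ "3 / 10"] exI[of _ space_bound]) simp
qed

end
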